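(* Let $C$ be an infinite cyclic group and let $M$ be a tame $\mathbb{Z}[C]$-module. If $\mu_M=(x-1)^mf$ with $m\geq0$, where $f$ is an integral polynomial such that $f(1)\in\{-1,1\}$, then $M$ is prenilpotent.
   Context: A finitely generated $\mathbb{Z}[C]$-module $M$ is tame if the group $M\rtimes C$ is finitely presented. For tame $M$, $\dim_{\mathbb{Q}}(M\otimes\mathbb{Q})<\infty$ and there is a generator $t$ of $C$ (an integral generator) such that the characteristic polynomial of $a_M:=t\otimes\mathbb{Q}:M\otimes\mathbb{Q}\to M\otimes\mathbb{Q}$ has integer coefficients; $\mu_M$ denotes the minimal polynomial of $a_M$ for such a fixed $t$ (it is a monic integral polynomial). A $\mathbb{Z}[C]$-module $N$ is prenilpotent if $NI^n=NI^{n+1}$ for all sufficiently large $n$, where $I$ is the augmentation ideal of $\mathbb{Z}[C]$. *)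

theory Defs
  imports "HOL-Algebra.Elementary_Groups" "HOL-Library.Poly_Mapping" "Jordan_Normal_Form.Char_Poly"
begin

text \<open>A letter is a pair of a generator and an exponent sign (\<open>True\<close> for \<open>x\<close>, \<open>False\<close> for the
  inverse of \<open>x\<close>). The free group is realised on reduced words.\<close>

definition inverse_letters :: "'a \<times> bool \<Rightarrow> 'a \<times> bool \<Rightarrow> bool" where
  "inverse_letters a b \<longleftrightarrow> fst a = fst b \<and> snd a \<noteq> snd b"

definition reduced :: "('a \<times> bool) list \<Rightarrow> bool" where
  "reduced = successively (\<lambda>a b. \<not> inverse_letters a b)"

definition cancel_cons :: "'a \<times> bool \<Rightarrow> ('a \<times> bool) list \<Rightarrow> ('a \<times> bool) list" where
  "cancel_cons a w = (if w \<noteq> [] \<and> inverse_letters a (hd w) then tl w else a # w)"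

definition free_group :: "'a set \<Rightarrow> ('a \<times> bool) list monoid" where
  "free_group S =
     \<lparr>carrier = {w. set w \<subseteq> S \<times> UNIV \<and> reduced w}, monoid.mult = foldr cancel_cons, one = []\<rparr>"

definition normal_closure :: "('a, 'b) monoid_scheme \<Rightarrow> 'a set \<Rightarrow> 'a set" where
  "normal_closure G R = generate G {g \<otimes>\<^bsub>G\<^esub> r \<otimes>\<^bsub>G\<^esub> inv\<^bsub>G\<^esub> g | g r. g \<in> carrier G \<and> r \<in> R}"

definition finitely_presented :: "('a, 'b) monoid_scheme \<Rightarrow> bool" where
  "finitely_presented G \<longleftrightarrow>
     (\<exists>(n::nat) R. finite R \<and> R \<subseteq> carrier (free_group {..<n}) \<and>
        free_group {..<n} Mod normal_closure (free_group {..<n}) R \<cong> G)"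

lemma reduced_Nil [simp]: "reduced []"
  by (simp add: reduced_def)

lemma reduced_Cons:
  "reduced (a # w) \<longleftrightarrow> reduced w \<and> (w \<noteq> [] \<longrightarrow> \<not> inverse_letters a (hd w))"
  by (cases w) (auto simp: reduced_def)

lemma reduced_cancel_cons: "reduced w \<Longrightarrow> reduced (cancel_cons a w)"
  by (cases w) (auto simp: cancel_cons_def reduced_Cons)

lemma reduced_foldr: "reduced w \<Longrightarrow> reduced (foldr cancel_cons u w)"
  by (induction u) (auto intro: reduced_cancel_cons)

lemma set_cancel_cons: "set (cancel_cons a w) \<subseteq> insert a (set w)"
  by (cases w) (auto simp: cancel_cons_def)

lemma set_foldr: "set (foldr cancel_cons u w) \<subseteq> set u \<union> set w"
  by (induction u) (use set_cancel_cons in fastforce)+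

lemma cancel_cons_inverse:
  assumes "reduced w" "inverse_letters a b"
  shows "cancel_cons a (cancel_cons b w) = w"
proof (cases w)
  case (Cons c v)
  show ?thesis
  proof (cases "inverse_letters b c")
    case True
    then have "c = a" using assms(2) by (auto simp: inverse_letters_def prod_eq_iff)
    then show ?thesis using assms(1) True Cons
      by (auto simp: cancel_cons_def reduced_Cons)
  qed (use Cons assms in \<open>auto simp: cancel_cons_def\<close>)
qed (use assms in \<open>auto simp: cancel_cons_def\<close>)

lemma foldr_cancel_cons:
  assumes "reduced w"
  shows "foldr cancel_cons (cancel_cons a u) w = cancel_cons a (foldr cancel_cons u w)"
proof (cases "u \<noteq> [] \<and> inverse_letters a (hd u)")
  case True
  then obtain b v where u: "u = b # v" by (cases u) auto
  with True have "inverse_letters a b" by simp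
  then have "cancel_cons a u = v" by (simp add: u cancel_cons_def)
  moreover have "cancel_cons a (foldr cancel_cons u w) = foldr cancel_cons v w"
    using \<open>inverse_letters a b\<close> by (simp add: u cancel_cons_inverse reduced_foldr assms)
  ultimately show ?thesis by simp
qed (auto simp: cancel_cons_def[of a u])

lemma foldr_assoc:
  "reduced w \<Longrightarrow>
    foldr cancel_cons (foldr cancel_cons u v) w = foldr cancel_cons u (foldr cancel_cons v w)"
  by (induction u) (auto simp: foldr_cancel_cons)

lemma foldr_reduced: "reduced u \<Longrightarrow> foldr cancel_cons u [] = u"
  by (induction u) (auto simp: reduced_Cons cancel_cons_def)

lemma group_free_group: "group (free_group S)"
proof (rule groupI)
  fix x assume x: "x \<in> carrier (free_group S)"
  show "\<exists>y\<in>carrier (free_group S). y \<otimes>\<^bsub>free_group S\<^esub> x = \<one>\<^bsub>free_group S\<^esub>"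
  proof -
    let ?i = "map (\<lambda>(a, e). (a, \<not> e))"
    have *: "foldr cancel_cons (rev (?i x)) (x @ v) = v" if "reduced (x @ v)" for x v
      using that
    proof (induction x arbitrary: v)
      case (Cons a x)
      then have "cancel_cons (fst a, \<not> snd a) (a # x @ v) = x @ v"
        by (auto simp: cancel_cons_def inverse_letters_def)
      then show ?case using Cons by (cases a) (auto simp: reduced_Cons)
    qed auto
    let ?y = "foldr cancel_cons (rev (?i x)) []"
    have "set ?y \<subseteq> set (rev (?i x))" using set_foldr[of "rev (?i x)" "[]"] by simp
    also have "\<dots> \<subseteq> S \<times> UNIV" using x by (fastforce simp: free_group_def)
    finally have "?y \<in> carrier (free_group S)"
      using reduced_foldr[of "[]"] by (simp add: free_group_def)
    moreover have "foldr cancel_cons ?y x = []"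
      using x *[of x "[]"] by (simp add: free_group_def foldr_assoc)
    ultimately show ?thesis by (auto simp: free_group_def)
  qed
qed (use reduced_foldr set_foldr in \<open>fastforce simp: free_group_def foldr_assoc\<close>)+

lemma subset_normal_closure:
  assumes "group G" "R \<subseteq> carrier G"
  shows "R \<subseteq> normal_closure G R"
proof
  interpret group G by fact
  fix r assume "r \<in> R"
  then have "\<one>\<^bsub>G\<^esub> \<otimes>\<^bsub>G\<^esub> r \<otimes>\<^bsub>G\<^esub> inv\<^bsub>G\<^esub> \<one>\<^bsub>G\<^esub> \<in> normal_closure G R"
    unfolding normal_closure_def by (intro generate.incl) blast
  then show "r \<in> normal_closure G R" using \<open>r \<in> R\<close> assms(2) by auto
qed

lemma normal_normal_closure:
  assumes "group G" "R \<subseteq> carrier G"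
  shows "normal_closure G R \<lhd> G"
proof -
  interpret group G by fact
  let ?X = "{g \<otimes>\<^bsub>G\<^esub> r \<otimes>\<^bsub>G\<^esub> inv\<^bsub>G\<^esub> g | g r. g \<in> carrier G \<and> r \<in> R}"
  have X: "?X \<subseteq> carrier G" using assms(2) by auto
  show ?thesis
    unfolding normal_closure_def
  proof (rule normal_generateI[OF X])
    fix h g assume "h \<in> ?X" and g: "g \<in> carrier G"
    then obtain k r where h: "h = k \<otimes>\<^bsub>G\<^esub> r \<otimes>\<^bsub>G\<^esub> inv\<^bsub>G\<^esub> k" and k: "k \<in> carrier G" and r: "r \<in> R"
      by auto
    have rc: "r \<in> carrier G" using r assms(2) by auto
    have "g \<otimes>\<^bsub>G\<^esub> h \<otimes>\<^bsub>G\<^esub> inv\<^bsub>G\<^esub> g = (g \<otimes>\<^bsub>G\<^esub> k) \<otimes>\<^bsub>G\<^esub> r \<otimes>\<^bsub>G\<^esub> inv\<^bsub>G\<^esub> (g \<otimes>\<^bsub>G\<^esub> k)"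
      using g k rc by (simp add: h inv_mult_group m_assoc)
    then show "g \<otimes>\<^bsub>G\<^esub> h \<otimes>\<^bsub>G\<^esub> inv\<^bsub>G\<^esub> g \<in> ?X" using g k r by blast
  qed
qed

text \<open>The abelian group \<open>C\<close> is a type \<open>'c :: ab_group_add\<close>, written additively. Its integral group
  ring is the ring \<open>'c \<Rightarrow>\<^sub>0 int\<close> of finitely supported functions with the convolution product.
  The group ring is commutative, so left and right modules coincide; a module is given by its
  scalar multiplication \<open>scale\<close>. Letting \<open>c\<close> or \<open>- c\<close> act in the semidirect product gives
  isomorphic groups, so the choice of convention is immaterial.\<close>

definition additive_group :: "'a::group_add monoid" where
  "additive_group = \<lparr>carrier = UNIV, monoid.mult = (+), one = 0\<rparr>"

definition group_elem :: "'c::ab_group_add \<Rightarrow> ('c \<Rightarrow>\<^sub>0 int)" where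
  "group_elem c = Poly_Mapping.single c 1"

lemma group_additive_group: "group (additive_group :: 'a::group_add monoid)"
  by (rule groupI) (auto simp: additive_group_def add.assoc intro: left_minus)

lemma group_elem_0: "group_elem 0 = 1"
  by (simp add: group_elem_def)

lemma group_elem_add: "group_elem (c + d) = group_elem c * group_elem d"
  by (simp add: group_elem_def mult_single)

definition fin_gen_module :: "('r::comm_ring_1 \<Rightarrow> 'm::ab_group_add \<Rightarrow> 'm) \<Rightarrow> bool" where
  "fin_gen_module scale \<longleftrightarrow> (\<exists>S. finite S \<and> Modules.module.span scale S = UNIV)"

definition semidirect ::
    "(('c::ab_group_add \<Rightarrow>\<^sub>0 int) \<Rightarrow> 'm::ab_group_add \<Rightarrow> 'm) \<Rightarrow> ('m \<times> 'c) monoid" where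
  "semidirect scale =
     \<lparr>carrier = UNIV,
      monoid.mult = (\<lambda>(m, c) (n, d). (m + scale (group_elem c) n, c + d)),
      one = (0, 0)\<rparr>"

lemma group_semidirect:
  assumes "Modules.module scale"
  shows "group (semidirect scale)"
proof -
  interpret Modules.module scale by fact
  show ?thesis
  proof (rule groupI)
    fix x assume "x \<in> carrier (semidirect scale)"
    obtain m c where x: "x = (m, c)" by (cases x)
    have "(- scale (group_elem (- c)) m, - c) \<otimes>\<^bsub>semidirect scale\<^esub> x = \<one>\<^bsub>semidirect scale\<^esub>"
      by (simp add: semidirect_def x)
    moreover have "(- scale (group_elem (- c)) m, - c) \<in> carrier (semidirect scale)"
      by (simp add: semidirect_def)
    ultimately show "\<exists>y\<in>carrier (semidirect scale). y \<otimes>\<^bsub>semidirect scale\<^esub> x = \<one>\<^bsub>semidirect scale\<^esub>"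
      by blast
  qed (auto simp: semidirect_def group_elem_0 group_elem_add scale_right_distrib add.assoc)
qed

definition tame :: "(('c::ab_group_add \<Rightarrow>\<^sub>0 int) \<Rightarrow> 'm::ab_group_add \<Rightarrow> 'm) \<Rightarrow> bool" where
  "tame scale \<longleftrightarrow> fin_gen_module scale \<and> finitely_presented (semidirect scale)"

definition augmentation_ideal :: "('c::ab_group_add \<Rightarrow>\<^sub>0 int) set" where
  "augmentation_ideal = {x. (\<Sum>c\<in>Poly_Mapping.keys x. Poly_Mapping.lookup x c) = 0}"

definition ideal_smult ::
    "('r::comm_ring_1 \<Rightarrow> 'm::ab_group_add \<Rightarrow> 'm) \<Rightarrow> 'r set \<Rightarrow> 'm set \<Rightarrow> 'm set" where
  "ideal_smult scale J N = Modules.module.span scale {scale r x | r x. r \<in> J \<and> x \<in> N}"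

text \<open>A ring is a module over itself by \<open>(*)\<close>, so \<open>ideal_smult (*)\<close> is the product of ideals.\<close>

fun ideal_power :: "'r::comm_ring_1 set \<Rightarrow> nat \<Rightarrow> 'r set" where
  "ideal_power J 0 = UNIV"
| "ideal_power J (Suc n) = ideal_smult (*) J (ideal_power J n)"

definition prenilpotent ::
    "(('c::ab_group_add \<Rightarrow>\<^sub>0 int) \<Rightarrow> 'm::ab_group_add \<Rightarrow> 'm) \<Rightarrow> bool" where
  "prenilpotent scale \<longleftrightarrow>
     (\<exists>k. \<forall>n\<ge>k. ideal_smult scale (ideal_power augmentation_ideal n) UNIV =
                ideal_smult scale (ideal_power augmentation_ideal (Suc n)) UNIV)"

definition tensor_relations ::
    "(('a::ab_group_add \<times> 'b::ab_group_add) \<Rightarrow>\<^sub>0 int) set" where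
  "tensor_relations = Modules.module.span frag_cmul
     ({frag_of (a + a', b) - frag_of (a, b) - frag_of (a', b) | a a' b. True} \<union>
      {frag_of (a, b + b') - frag_of (a, b) - frag_of (a, b') | a b b'. True})"

lemma module_frag_cmul: "Modules.module frag_cmul"
  by unfold_locales (auto simp: frag_cmul_distrib frag_cmul_distrib2)

lemma tensor_relations_0: "0 \<in> tensor_relations"
  unfolding tensor_relations_def by (rule module.span_zero[OF module_frag_cmul])

lemma tensor_relations_add:
  "x \<in> tensor_relations \<Longrightarrow> y \<in> tensor_relations \<Longrightarrow> x + y \<in> tensor_relations"
  unfolding tensor_relations_def by (rule module.span_add[OF module_frag_cmul])

lemma tensor_relations_minus: "x \<in> tensor_relations \<Longrightarrow> - x \<in> tensor_relations"
  unfolding tensor_relations_def by (rule module.span_neg[OF module_frag_cmul])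

quotient_type (overloaded) ('a, 'b) tensor = "('a::ab_group_add \<times> 'b::ab_group_add) \<Rightarrow>\<^sub>0 int" /
  "\<lambda>x y. x - y \<in> tensor_relations"
proof (rule equivpI)
  show "reflp (\<lambda>x y. x - y \<in> tensor_relations)"
    by (simp add: reflp_def tensor_relations_0)
  show "symp (\<lambda>x y. x - y \<in> tensor_relations)"
    by (intro sympI) (use tensor_relations_minus in force)
  show "transp (\<lambda>x y. x - y \<in> tensor_relations)"
    by (intro transpI) (use tensor_relations_add in force)
qed

instantiation tensor :: (ab_group_add, ab_group_add) ab_group_add
begin

lift_definition zero_tensor :: "('a, 'b) tensor" is 0 .

lift_definition plus_tensor :: "('a, 'b) tensor \<Rightarrow> ('a, 'b) tensor \<Rightarrow> ('a, 'b) tensor" is "(+)"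
  unfolding add_diff_add by (rule tensor_relations_add)

lift_definition uminus_tensor :: "('a, 'b) tensor \<Rightarrow> ('a, 'b) tensor" is uminus
  unfolding minus_diff_minus by (rule tensor_relations_minus)

lift_definition minus_tensor :: "('a, 'b) tensor \<Rightarrow> ('a, 'b) tensor \<Rightarrow> ('a, 'b) tensor" is "(-)"
proof -
  fix x y z w :: "('a \<times> 'b) \<Rightarrow>\<^sub>0 int"
  assume "x - y \<in> tensor_relations" "z - w \<in> tensor_relations"
  then have "(x - y) + - (z - w) \<in> tensor_relations"
    by (intro tensor_relations_add tensor_relations_minus)
  then show "(x - z) - (y - w) \<in> tensor_relations" by (simp add: algebra_simps)
qed

instance
  by standard (transfer; simp add: algebra_simps tensor_relations_0)+

end

lift_definition pure_tensor :: "'a::ab_group_add \<Rightarrow> 'b::ab_group_add \<Rightarrow> ('a, 'b) tensor"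
  is "\<lambda>a b. frag_of (a, b)" .

text \<open>The map \<open>f \<otimes> g\<close>, meaningful for additive \<open>f\<close> and \<open>g\<close> only: it does not depend on the
  representative of \<open>x\<close> by \<open>tensor_map_pure\<close> and \<open>tensor_map_add\<close> below.\<close>

definition tensor_map ::
    "('a::ab_group_add \<Rightarrow> 'a'::ab_group_add) \<Rightarrow> ('b::ab_group_add \<Rightarrow> 'b'::ab_group_add) \<Rightarrow>
     ('a, 'b) tensor \<Rightarrow> ('a', 'b') tensor" where
  "tensor_map f g x = abs_tensor (frag_extend (frag_of \<circ> map_prod f g) (rep_tensor x))"

lemma pure_tensor_add_left: "pure_tensor (a + a') b = pure_tensor a b + pure_tensor a' b"
proof (transfer)
  fix a a' :: 'a and b :: 'b
  have "frag_of (a + a', b) - frag_of (a, b) - frag_of (a', b) \<in> tensor_relations"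
    unfolding tensor_relations_def by (rule module.span_base[OF module_frag_cmul]) blast
  then show "frag_of (a + a', b) - (frag_of (a, b) + frag_of (a', b)) \<in> tensor_relations"
    by (simp add: algebra_simps)
qed

lemma pure_tensor_add_right: "pure_tensor a (b + b') = pure_tensor a b + pure_tensor a b'"
proof (transfer)
  fix a :: 'a and b b' :: 'b
  have "frag_of (a, b + b') - frag_of (a, b) - frag_of (a, b') \<in> tensor_relations"
    unfolding tensor_relations_def by (rule module.span_base[OF module_frag_cmul]) blast
  then show "frag_of (a, b + b') - (frag_of (a, b) + frag_of (a, b')) \<in> tensor_relations"
    by (simp add: algebra_simps)
qed

lemma tensor_relations_map:
  assumes f: "\<And>a a'. f (a + a') = f a + f a'" and g: "\<And>b b'. g (b + b') = g b + g b'"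
    and x: "x \<in> tensor_relations"
  shows "frag_extend (frag_of \<circ> map_prod f g) x \<in> tensor_relations"
  using x unfolding tensor_relations_def
proof (induction rule: module.span_induct_alt[OF module_frag_cmul, consumes 1])
  case 1
  show ?case by (simp add: module.span_zero[OF module_frag_cmul])
next
  case (2 c x y)
  from 2(1) have "frag_extend (frag_of \<circ> map_prod f g) x \<in> tensor_relations"
    unfolding tensor_relations_def
    by (intro module.span_base[OF module_frag_cmul])
       (use f g in \<open>fastforce simp: frag_extend_diff\<close>)
  then show ?case using 2(2) unfolding tensor_relations_def
    unfolding frag_extend_add frag_extend_cmul
    by (intro module.span_add[OF module_frag_cmul] module.span_scale[OF module_frag_cmul])
qed

lemma tensor_map_abs:
  assumes f: "\<And>a a'. f (a + a') = f a + f a'" and g: "\<And>b b'. g (b + b') = g b + g b'"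
  shows "tensor_map f g (abs_tensor x) = abs_tensor (frag_extend (frag_of \<circ> map_prod f g) x)"
proof -
  have "abs_tensor (rep_tensor (abs_tensor x)) = abs_tensor x"
    by (rule Quotient3_abs_rep[OF Quotient3_tensor])
  then have "rep_tensor (abs_tensor x) - x \<in> tensor_relations"
    by (simp add: tensor.abs_eq_iff)
  from tensor_relations_map[OF f g this] show ?thesis
    by (simp add: tensor_map_def tensor.abs_eq_iff frag_extend_diff)
qed

lemma tensor_map_pure:
  assumes "\<And>a a'. f (a + a') = f a + f a'" "\<And>b b'. g (b + b') = g b + g b'"
  shows "tensor_map f g (pure_tensor a b) = pure_tensor (f a) (g b)"
  by (simp add: pure_tensor.abs_eq tensor_map_abs[where f = f and g = g, OF assms])

lemma tensor_map_add:
  assumes "\<And>a a'. f (a + a') = f a + f a'" "\<And>b b'. g (b + b') = g b + g b'"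
  shows "tensor_map f g (x + y) = tensor_map f g x + tensor_map f g y"
  by (induction x rule: tensor.abs_induct; induction y rule: tensor.abs_induct)
     (simp add: plus_tensor.abs_eq tensor_map_abs[where f = f and g = g, OF assms] frag_extend_add)

lemma tensor_induct [case_names zero pure diff]:
  assumes "P 0" "\<And>a b. P (pure_tensor a b)" "\<And>x y. P x \<Longrightarrow> P y \<Longrightarrow> P (x - y)"
  shows "P x"
proof (induction x rule: tensor.abs_induct)
  case (1 y)
  have "Poly_Mapping.keys y \<subseteq> UNIV" by simp
  then show ?case
    by (induction y rule: frag_induction)
       (use assms in \<open>auto simp: zero_tensor.abs_eq pure_tensor.abs_eq simp flip: minus_tensor.abs_eq\<close>)
qed

definition rat_scale :: "rat \<Rightarrow> ('m::ab_group_add, rat) tensor \<Rightarrow> ('m, rat) tensor" where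
  "rat_scale q = tensor_map id ((*) q)"

lemma rat_scale_pure: "rat_scale q (pure_tensor a r) = pure_tensor a (q * r)"
  by (simp add: rat_scale_def tensor_map_pure distrib_left)

lemma rat_scale_add: "rat_scale q (x + y) = rat_scale q x + rat_scale q y"
  by (simp add: rat_scale_def tensor_map_add distrib_left)

lemma vector_space_rat_scale:
  "vector_space (rat_scale :: rat \<Rightarrow> ('m::ab_group_add, rat) tensor \<Rightarrow> _)"
proof
  have 0: "rat_scale q (0 :: ('m, rat) tensor) = 0" for q
    using rat_scale_add[of q "0 :: ('m, rat) tensor" 0] by simp
  have diff: "rat_scale q (x - y) = rat_scale q x - rat_scale q y" for q and x y :: "('m, rat) tensor"
    using rat_scale_add[of q "x - y" y] by (simp add: algebra_simps)
  fix a b :: rat and x y :: "('m, rat) tensor"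
  show "rat_scale a (x + y) = rat_scale a x + rat_scale a y" by (rule rat_scale_add)
  show "rat_scale (a + b) x = rat_scale a x + rat_scale b x"
    by (induction x rule: tensor_induct)
       (simp_all add: 0 diff rat_scale_pure distrib_right pure_tensor_add_right)
  show "rat_scale a (rat_scale b x) = rat_scale (a * b) x"
    by (induction x rule: tensor_induct) (simp_all add: 0 diff rat_scale_pure mult.assoc)
  show "rat_scale 1 x = x"
    by (induction x rule: tensor_induct) (simp_all add: 0 diff rat_scale_pure)
qed

definition rat_action ::
    "(('c::ab_group_add \<Rightarrow>\<^sub>0 int) \<Rightarrow> 'm::ab_group_add \<Rightarrow> 'm) \<Rightarrow> 'c \<Rightarrow>
     ('m, rat) tensor \<Rightarrow> ('m, rat) tensor" where
  "rat_action scale t = tensor_map (scale (group_elem t)) id"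

text \<open>The polynomial is that of the matrix of \<open>T\<close> in some finite basis \<open>vs\<close>, on which it does not
  depend; the existence of \<open>vs\<close> makes finite-dimensionality part of the predicate.\<close>

definition is_char_poly_of ::
    "('k::field \<Rightarrow> 'v::ab_group_add \<Rightarrow> 'v) \<Rightarrow> ('v \<Rightarrow> 'v) \<Rightarrow> 'k poly \<Rightarrow> bool" where
  "is_char_poly_of scale T p \<longleftrightarrow>
     (\<exists>vs A. distinct vs \<and> \<not> Modules.module.dependent scale (set vs) \<and>
        Modules.module.span scale (set vs) = UNIV \<and>
        A \<in> carrier_mat (length vs) (length vs) \<and>
        (\<forall>j<length vs. T (vs ! j) = (\<Sum>i<length vs. scale (A $$ (i, j)) (vs ! i))) \<and>
        p = char_poly A)"

definition poly_endo ::
    "('k::field \<Rightarrow> 'v::ab_group_add \<Rightarrow> 'v) \<Rightarrow> 'k poly \<Rightarrow> ('v \<Rightarrow> 'v) \<Rightarrow> 'v \<Rightarrow> 'v" where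
  "poly_endo scale p T v = (\<Sum>i\<le>degree p. scale (coeff p i) ((T ^^ i) v))"

definition is_min_poly_of ::
    "('k::field \<Rightarrow> 'v::ab_group_add \<Rightarrow> 'v) \<Rightarrow> ('v \<Rightarrow> 'v) \<Rightarrow> 'k poly \<Rightarrow> bool" where
  "is_min_poly_of scale T p \<longleftrightarrow>
     lead_coeff p = 1 \<and> (\<forall>v. poly_endo scale p T v = 0) \<and>
     (\<forall>q. lead_coeff q = 1 \<and> (\<forall>v. poly_endo scale q T v = 0) \<longrightarrow> degree p \<le> degree q)"

definition integral_generator ::
    "(('c::ab_group_add \<Rightarrow>\<^sub>0 int) \<Rightarrow> 'm::ab_group_add \<Rightarrow> 'm) \<Rightarrow> 'c \<Rightarrow> bool" where
  "integral_generator scale t \<longleftrightarrow>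
     generate additive_group {t} = UNIV \<and>
     (\<exists>p :: int poly. is_char_poly_of rat_scale (rat_action scale t) (of_int_poly p))"

end

theory Submission
  imports Defs
begin

text \<open>
  Write \<open>a = t - 1\<close>. Since \<open>t\<close> generates \<open>C\<close>, the augmentation ideal \<open>I\<close> is generated by \<open>a\<close>, so
  \<open>M I^n = a^n M\<close> and the claim is that this decreasing chain becomes stationary. It is compared
  with the torsion subgroup \<open>T\<close> of the additive group of \<open>M\<close>.

  Modulo \<open>T\<close> the chain is stationary from \<open>m\<close> on. The minimal polynomial annihilates \<open>M \<otimes> \<rat>\<close>, and
  the kernel of \<open>M \<rightarrow> M \<otimes> \<rat>\<close> is \<open>T\<close>, so \<open>a^m f(t) M \<subseteq> T\<close>. As \<open>f(t) = f(1) + a h\<close> with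
  \<open>f(1) = \<plusminus>1\<close>, this gives \<open>a^n x \<in> a^(n+1) M + T\<close> for \<open>n \<ge> m\<close>, where the torsion summand is itself
  a multiple of \<open>a^n\<close>. It remains to know that \<open>T \<inter> a^n M\<close> is eventually constant, for which it
  suffices that \<open>T\<close> is finite.

  That \<open>T\<close> is finite is the part of the theorem of Bieri and Strebel which uses finite
  presentability (\<open>finite_torsion\<close>). Let \<open>\<langle>x\<^sub>i | R\<rangle>\<close> be a finite presentation of \<open>M \<rtimes> \<int>\<close> in which
  \<open>x\<^sub>i\<close> stands for \<open>(m\<^sub>i, d\<^sub>i)\<close>, and let \<open>A\<close> be the subgroup of \<open>M\<close> generated by the \<open>t^k m\<^sub>i\<close> with
  \<open>-K < k \<le> K\<close>. On the set \<open>M \<times> \<int>\<close> consider the translations \<open>T\<^sub>b (x, i) = (x + b, i)\<close> and the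
  permutation \<open>\<tau> (x, i) = (t x, i + [t x \<in> A])\<close>. The relation \<open>\<tau> T\<^sub>b = T\<^sub>t\<^sub>b \<tau>\<close> holds whenever
  \<open>t b \<in> A\<close>. A relator of bounded length only involves such \<open>b\<close> once \<open>K\<close> is large, so
  \<open>x\<^sub>i \<mapsto> T\<^sub>m \<tau>^d\<close> (with \<open>m = m\<^sub>i\<close> and \<open>d = d\<^sub>i\<close>) extends to a homomorphism on all of \<open>M \<rtimes> \<int>\<close>. It
  maps the commuting elements \<open>t^(-K) m\<^sub>i\<close> and \<open>t (t^K m\<^sub>j)\<close> to \<open>T\<^sub>b\<close> and \<open>\<tau> T\<^sub>c \<tau>^(-1)\<close> with
  \<open>b = t^(-K) m\<^sub>i\<close> and \<open>c = t^K m\<^sub>j\<close>; these permutations commute only if \<open>b \<in> A\<close> or \<open>t c \<in> A\<close>. Hence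
  \<open>t\<close> or its inverse maps \<open>A\<close> into itself, and \<open>M\<close> is an ascending union of copies of the finitely
  generated abelian group \<open>A\<close>. Every finite set of torsion elements of \<open>M\<close> embeds in the finite
  torsion subgroup of \<open>A\<close>, which bounds its size. This replaces the usual argument with HNN
  extensions and free subgroups.
\<close>

section \<open>Words and presentations\<close>

definition letter_value :: "('g, 'b) monoid_scheme \<Rightarrow> ('a \<Rightarrow> 'g) \<Rightarrow> 'a \<times> bool \<Rightarrow> 'g" where
  "letter_value G \<gamma> l = (if snd l then \<gamma> (fst l) else inv\<^bsub>G\<^esub> \<gamma> (fst l))"

definition word_value :: "('g, 'b) monoid_scheme \<Rightarrow> ('a \<Rightarrow> 'g) \<Rightarrow> ('a \<times> bool) list \<Rightarrow> 'g" where
  "word_value G \<gamma> w = foldr (\<lambda>l g. letter_value G \<gamma> l \<otimes>\<^bsub>G\<^esub> g) w \<one>\<^bsub>G\<^esub>"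

lemma word_value_Nil [simp]: "word_value G \<gamma> [] = \<one>\<^bsub>G\<^esub>"
  by (simp add: word_value_def)

lemma word_value_Cons [simp]:
  "word_value G \<gamma> (l # w) = letter_value G \<gamma> l \<otimes>\<^bsub>G\<^esub> word_value G \<gamma> w"
  by (simp add: word_value_def)

lemma free_group_mult: "u \<otimes>\<^bsub>free_group S\<^esub> v = foldr cancel_cons u v"
  by (simp add: free_group_def)

lemma free_group_one: "\<one>\<^bsub>free_group S\<^esub> = []"
  by (simp add: free_group_def)

lemma singleton_in_free_group: "a \<in> S \<Longrightarrow> [(a, e)] \<in> carrier (free_group S)"
  by (simp add: free_group_def reduced_Cons)

lemma free_group_Cons:
  assumes "l # w \<in> carrier (free_group S)"
  shows "fst l \<in> S" "w \<in> carrier (free_group S)" "l # w = [l] \<otimes>\<^bsub>free_group S\<^esub> w"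
  using assms by (auto simp: free_group_def reduced_Cons cancel_cons_def)

context group
begin

lemma letter_value_closed: "\<gamma> \<in> S \<rightarrow> carrier G \<Longrightarrow> fst l \<in> S \<Longrightarrow> letter_value G \<gamma> l \<in> carrier G"
  by (auto simp: letter_value_def)

lemma word_value_closed:
  "\<gamma> \<in> S \<rightarrow> carrier G \<Longrightarrow> set w \<subseteq> S \<times> UNIV \<Longrightarrow> word_value G \<gamma> w \<in> carrier G"
  by (induction w) (auto intro!: m_closed letter_value_closed[where S = S])

text \<open>
  A cancelled pair of letters has trivial value; this makes evaluation of words compatible with the
  product of reduced words.
\<close>
lemma word_value_cancel_cons:
  assumes "\<gamma> \<in> S \<rightarrow> carrier G" "fst l \<in> S" "set w \<subseteq> S \<times> UNIV"
  shows "word_value G \<gamma> (cancel_cons l w) = letter_value G \<gamma> l \<otimes> word_value G \<gamma> w"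
proof (cases "w \<noteq> [] \<and> inverse_letters l (hd w)")
  case True
  then obtain k v where w: "w = k # v" by (cases w) auto
  have v: "word_value G \<gamma> v \<in> carrier G" and k: "letter_value G \<gamma> k \<in> carrier G"
    and l: "letter_value G \<gamma> l \<in> carrier G"
    using assms w by (auto intro!: word_value_closed[where S = S] letter_value_closed[where S = S])
  have "letter_value G \<gamma> l \<otimes> letter_value G \<gamma> k = \<one>"
    using True w assms by (auto simp: inverse_letters_def letter_value_def Pi_iff)
  then show ?thesis
    using True w v k l by (simp add: cancel_cons_def m_assoc[symmetric])
qed (auto simp: cancel_cons_def)

lemma word_value_hom:
  assumes \<gamma>: "\<gamma> \<in> S \<rightarrow> carrier G"
  shows "word_value G \<gamma> \<in> hom (free_group S) G"
proof (rule homI)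
  fix u v assume "u \<in> carrier (free_group S)" "v \<in> carrier (free_group S)"
  then have u: "set u \<subseteq> S \<times> UNIV" and v: "set v \<subseteq> S \<times> UNIV"
    by (auto simp: free_group_def)
  from u have "word_value G \<gamma> (foldr cancel_cons u v) = word_value G \<gamma> u \<otimes> word_value G \<gamma> v"
  proof (induction u)
    case Nil
    then show ?case using word_value_closed[OF \<gamma> v] by simp
  next
    case (Cons l u)
    have "set (foldr cancel_cons u v) \<subseteq> S \<times> UNIV"
      using set_foldr[of u v] Cons.prems v by auto
    moreover have "word_value G \<gamma> u \<in> carrier G" "letter_value G \<gamma> l \<in> carrier G"
      using Cons.prems \<gamma>
      by (auto intro!: word_value_closed[where S = S] letter_value_closed[where S = S])
    ultimately show ?case
      using Cons word_value_closed[OF \<gamma> v]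
      by (auto simp: word_value_cancel_cons[OF \<gamma>] m_assoc mem_Times_iff)
  qed
  then show "word_value G \<gamma> (u \<otimes>\<^bsub>free_group S\<^esub> v) = word_value G \<gamma> u \<otimes> word_value G \<gamma> v"
    by (simp add: free_group_mult)
qed (auto simp: free_group_def intro!: word_value_closed[OF \<gamma>])

text \<open>
  A homomorphism out of the free group is evaluation of words at the images of the generators.
  This allows the values of a word in two groups to be compared by induction on the word.
\<close>
lemma hom_eq_word_value:
  assumes \<phi>: "\<phi> \<in> hom (free_group S) G" and w: "w \<in> carrier (free_group S)"
  shows "\<phi> w = word_value G (\<lambda>a. \<phi> [(a, True)]) w"
  using w
proof (induction w)
  interpret F: group "free_group S" by (rule group_free_group)
  interpret \<phi>: group_hom "free_group S" G \<phi>
    using \<phi> by (simp add: group_hom_def group_hom_axioms_def F.is_group is_group)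
  case Nil
  then show ?case using \<phi>.hom_one by (simp add: free_group_one)
next
  interpret F: group "free_group S" by (rule group_free_group)
  interpret \<phi>: group_hom "free_group S" G \<phi>
    using \<phi> by (simp add: group_hom_def group_hom_axioms_def F.is_group is_group)
  case (Cons l w)
  note lw = free_group_Cons[OF Cons.prems]
  obtain a e where l: "l = (a, e)" by (cases l)
  have a: "[(a, e)] \<in> carrier (free_group S)" for e
    using lw(1) by (simp add: l singleton_in_free_group)
  have "[(a, False)] \<otimes>\<^bsub>free_group S\<^esub> [(a, True)] = \<one>\<^bsub>free_group S\<^esub>"
    by (simp add: free_group_mult free_group_one cancel_cons_def inverse_letters_def)
  then have "[(a, False)] = inv\<^bsub>free_group S\<^esub> [(a, True)]"
    using a by (metis F.inv_equality)
  then have "\<phi> [l] = letter_value G (\<lambda>a. \<phi> [(a, True)]) l"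
    using a by (simp add: l letter_value_def \<phi>.hom_inv)
  moreover have "\<phi> (l # w) = \<phi> [l] \<otimes> \<phi> w"
    using lw(2) a by (subst lw(3)) (simp add: l \<phi>.hom_mult)
  ultimately show ?case using Cons.IH lw(2) by simp
qed

lemma finitely_presentedE:
  assumes "finitely_presented G"
  obtains n R \<phi> where "finite R" "R \<subseteq> carrier (free_group {..<n::nat})"
    "\<phi> \<in> hom (free_group {..<n}) G" "\<phi> ` carrier (free_group {..<n}) = carrier G"
    "kernel (free_group {..<n}) G \<phi> = normal_closure (free_group {..<n}) R"
proof -
  from assms obtain n R h where R: "finite R" "R \<subseteq> carrier (free_group {..<n::nat})"
    and h: "h \<in> iso (free_group {..<n} Mod normal_closure (free_group {..<n}) R) G"
    unfolding finitely_presented_def is_iso_def by blast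
  define F where "F = free_group {..<n}"
  define N where "N = normal_closure F R"
  interpret F: group F unfolding F_def by (rule group_free_group)
  interpret N: normal N F
    unfolding N_def by (rule normal_normal_closure) (use R in \<open>auto simp: F_def F.is_group group_free_group\<close>)
  have h': "h \<in> hom (F Mod N) G" "bij_betw h (carrier (F Mod N)) (carrier G)"
    using h by (auto simp: iso_def F_def N_def)
  define \<phi> where "\<phi> = h \<circ> (\<lambda>a. N #>\<^bsub>F\<^esub> a)"
  have hom: "\<phi> \<in> hom F G"
    unfolding \<phi>_def by (rule Group.hom_compose[OF N.r_coset_hom_Mod h'(1)])
  have img: "(\<lambda>a. N #>\<^bsub>F\<^esub> a) ` carrier F = carrier (F Mod N)"
    by (auto simp: FactGroup_def RCOSETS_def)
  have surj: "\<phi> ` carrier F = carrier G"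
    using h'(2) unfolding \<phi>_def image_comp[symmetric] img by (simp add: bij_betw_def)
  have h1: "h \<one>\<^bsub>F Mod N\<^esub> = \<one>"
    using hom_one[OF h'(1) N.factorgroup_is_group is_group] .
  have "\<phi> x = \<one> \<longleftrightarrow> x \<in> N" if x: "x \<in> carrier F" for x
  proof -
    have "\<phi> x = \<one> \<longleftrightarrow> h (N #>\<^bsub>F\<^esub> x) = h \<one>\<^bsub>F Mod N\<^esub>" by (simp only: \<phi>_def o_def h1)
    also have "\<dots> \<longleftrightarrow> N #>\<^bsub>F\<^esub> x = \<one>\<^bsub>F Mod N\<^esub>"
    proof (rule inj_on_eq_iff[OF bij_betw_imp_inj_on[OF h'(2)]])
      show "N #>\<^bsub>F\<^esub> x \<in> carrier (F Mod N)" using x img by blast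
      show "\<one>\<^bsub>F Mod N\<^esub> \<in> carrier (F Mod N)"
        using N.factorgroup_is_group by (rule monoid.one_closed[OF group.is_monoid])
    qed
    also have "\<dots> \<longleftrightarrow> x \<in> N"
      using F.coset_join1[OF _ x N.is_subgroup] F.coset_join2[OF x N.is_subgroup]
      by (auto simp: FactGroup_def)
    finally show ?thesis .
  qed
  then have "kernel F G \<phi> = N"
    using N.subset by (auto simp: kernel_def)
  with hom surj show ?thesis
    using that[of R n \<phi>] R by (simp add: F_def N_def)
qed

text \<open>
  Von Dyck's theorem: killing the relators suffices to descend from the free group to the presented
  group, because the kernel of \<open>\<psi>\<close> is normal and therefore contains the normal closure of \<open>R\<close>.
\<close>
lemma von_Dyck:
  assumes F: "group F" and \<phi>: "\<phi> \<in> hom F G" "\<phi> ` carrier F = carrier G"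
    and ker: "kernel F G \<phi> = normal_closure F R" and R: "R \<subseteq> carrier F"
    and H: "group H" and \<psi>: "\<psi> \<in> hom F H" "\<And>r. r \<in> R \<Longrightarrow> \<psi> r = \<one>\<^bsub>H\<^esub>"
  obtains \<Psi> where "\<Psi> \<in> hom G H" "\<And>w. w \<in> carrier F \<Longrightarrow> \<Psi> (\<phi> w) = \<psi> w"
proof -
  interpret F: group F by fact
  interpret H: group H by fact
  interpret \<phi>: group_hom F G \<phi>
    using \<phi> by (simp add: group_hom_def group_hom_axioms_def F.is_group is_group)
  interpret \<psi>: group_hom F H \<psi>
    using \<psi> by (simp add: group_hom_def group_hom_axioms_def F.is_group H.is_group)
  have "R \<subseteq> kernel F H \<psi>" using R \<psi>(2) by (auto simp: kernel_def)
  then have "normal_closure F R \<subseteq> kernel F H \<psi>"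
    unfolding normal_closure_def
    using R
    by (intro F.generate_subgroup_incl \<psi>.subgroup_kernel)
      (auto simp: subset_iff normal.inv_op_closed2[OF \<psi>.normal_kernel])
  then have sub: "kernel F G \<phi> \<subseteq> kernel F H \<psi>" by (simp add: ker)
  have eq: "\<psi> u = \<psi> v" if uv: "u \<in> carrier F" "v \<in> carrier F" "\<phi> u = \<phi> v" for u v
  proof -
    have "u \<otimes>\<^bsub>F\<^esub> inv\<^bsub>F\<^esub> v \<in> kernel F G \<phi>" using uv by (simp add: kernel_def)
    then have "\<psi> (u \<otimes>\<^bsub>F\<^esub> inv\<^bsub>F\<^esub> v) = \<one>\<^bsub>H\<^esub>" using sub by (auto simp: kernel_def)
    then have "\<psi> u \<otimes>\<^bsub>H\<^esub> inv\<^bsub>H\<^esub> \<psi> v = \<one>\<^bsub>H\<^esub>" using uv by simp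
    then show ?thesis using uv by (simp add: H.inv_solve_right')
  qed
  define \<Psi> where "\<Psi> g = \<psi> (inv_into (carrier F) \<phi> g)" for g
  have \<Psi>: "\<Psi> (\<phi> w) = \<psi> w" if "w \<in> carrier F" for w
    unfolding \<Psi>_def by (rule eq) (use that in \<open>auto intro: inv_into_into f_inv_into_f\<close>)
  have "\<Psi> \<in> hom G H"
  proof (rule homI)
    fix x y assume "x \<in> carrier G" "y \<in> carrier G"
    then obtain u v where uv: "u \<in> carrier F" "v \<in> carrier F" "x = \<phi> u" "y = \<phi> v"
      using \<phi>(2) by blast
    then have "x \<otimes> y = \<phi> (u \<otimes>\<^bsub>F\<^esub> v)" by simp
    with uv show "\<Psi> (x \<otimes> y) = \<Psi> x \<otimes>\<^bsub>H\<^esub> \<Psi> y" by (simp add: \<Psi> del: \<phi>.hom_mult)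
  next
    fix x assume "x \<in> carrier G"
    then obtain u where "u \<in> carrier F" "x = \<phi> u" using \<phi>(2) by blast
    then show "\<Psi> x \<in> carrier H" by (simp add: \<Psi>)
  qed
  with \<Psi> show ?thesis using that by blast
qed

end

lemma finitely_presented_iso:
  assumes "finitely_presented G" "G \<cong> H"
  shows "finitely_presented H"
  using assms unfolding finitely_presented_def by (blast intro: iso_trans)

section \<open>Torsion in a finitely generated abelian group\<close>

text \<open>
  By induction on the generators. When \<open>s\<close> is added to \<open>X\<close>, either every torsion element already
  lies in the span of \<open>X\<close>, or some torsion element \<open>t = b0 + k0 s\<close> has \<open>k0 \<noteq> 0\<close>. In the second case,
  subtracting a multiple of \<open>t\<close> reduces the coefficient of \<open>s\<close> modulo \<open>k0\<close>, and two torsion elements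
  with the same reduced coefficient differ by a torsion element of the span of \<open>X\<close>. As \<open>t\<close> has finite
  order, only finitely many torsion elements arise.
\<close>
lemma finite_torsion_span:
  fixes sc :: "int \<Rightarrow> 'm::ab_group_add \<Rightarrow> 'm"
  assumes "Modules.module sc" and "finite X"
  shows "finite {x \<in> module.span sc X. \<exists>n\<noteq>0. sc n x = 0}"
  using \<open>finite X\<close>
proof (induction X)
  interpret Modules.module sc by fact
  case empty
  show ?case by (rule finite_subset[of _ "{0}"]) auto
next
  interpret Modules.module sc by fact
  case (insert s X)
  define T where "T = {x. \<exists>n\<noteq>0. sc n x = 0}"
  have T_scale: "sc k x \<in> T" if "x \<in> T" for k x
  proof -
    from that obtain n where "n \<noteq> 0" "sc n x = 0" by (auto simp: T_def)
    then have "sc n (sc k x) = 0" by (simp only: scale_left_commute[of n k] scale_zero_right)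
    with \<open>n \<noteq> 0\<close> show ?thesis by (auto simp: T_def)
  qed
  have T_add: "x + y \<in> T" if "x \<in> T" "y \<in> T" for x y
  proof -
    from that obtain m n where mn: "m \<noteq> 0" "n \<noteq> 0" "sc m x = 0" "sc n y = 0"
      by (auto simp: T_def)
    have "sc (m * n) (x + y) = sc n (sc m x) + sc m (sc n y)"
      by (simp add: scale_right_distrib mult.commute)
    then have "sc (m * n) (x + y) = 0" by (simp add: mn(3,4))
    moreover have "m * n \<noteq> 0" using mn by simp
    ultimately show ?thesis unfolding T_def by blast
  qed
  define D where "D = {k. \<exists>b\<in>span X. b + sc k s \<in> T}"
  have IH: "finite (span X \<inter> T)"
    by (rule finite_subset[OF _ insert.IH]) (auto simp: T_def)
  show ?case
  proof (cases "D \<subseteq> {0}")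
    case True
    have "{x \<in> span (insert s X). \<exists>n\<noteq>0. sc n x = 0} \<subseteq> span X \<inter> T"
    proof
      fix x assume "x \<in> {x \<in> span (insert s X). \<exists>n\<noteq>0. sc n x = 0}"
      then obtain k where k: "x - sc k s \<in> span X" and x: "x \<in> T"
        by (auto simp: span_insert T_def)
      then have "k \<in> D" unfolding D_def by force
      then show "x \<in> span X \<inter> T" using k x True by auto
    qed
    then show ?thesis using IH by (rule finite_subset)
  next
    case False
    then obtain k0 b0 where k0: "k0 \<noteq> 0" and b0: "b0 \<in> span X" and t0: "b0 + sc k0 s \<in> T"
      by (auto simp: D_def)
    define t where "t = b0 + sc k0 s"
    from t0 obtain e where e: "e \<noteq> 0" "sc e t = 0" by (auto simp: T_def t_def)
    \<comment> \<open>A representative for each coefficient modulo \<open>k0\<close>; it is arbitrary where no torsion element exists.\<close>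
    define rep where "rep r = (SOME x. x \<in> T \<and> x - sc r s \<in> span X)" for r
    let ?f = "\<lambda>(r, q, y). rep r + sc q t + y"
    have "{x \<in> span (insert s X). \<exists>n\<noteq>0. sc n x = 0}
        \<subseteq> ?f ` ({- \<bar>k0\<bar>..\<bar>k0\<bar>} \<times> {- \<bar>e\<bar>..\<bar>e\<bar>} \<times> (span X \<inter> T))"
    proof
      fix x assume "x \<in> {x \<in> span (insert s X). \<exists>n\<noteq>0. sc n x = 0}"
      then obtain k where k: "x - sc k s \<in> span X" and x: "x \<in> T"
        by (auto simp: span_insert T_def)
      define q r where "q = k div k0" and "r = k mod k0"
      have kqr: "k = q * k0 + r" by (simp add: q_def r_def)
      have tT: "t \<in> T" using t0 by (simp add: t_def)
      have neg: "- y \<in> T" if "y \<in> T" for y using T_scale[OF that, of "-1"] by simp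
      have 1: "x - sc q t \<in> T" using T_add[OF x neg[OF T_scale[OF tT, of q]]] by simp
      have "(x - sc q t) - sc r s = (x - sc k s) - sc q b0"
        by (simp add: t_def kqr scale_right_distrib scale_left_distrib)
      then have 2: "(x - sc q t) - sc r s \<in> span X"
        using span_diff[OF k span_scale[OF b0, of q]] by (simp only:)
      have rep: "rep r \<in> T \<and> rep r - sc r s \<in> span X"
        unfolding rep_def by (rule someI[of _ "x - sc q t"]) (use 1 2 in blast)
      define y where "y = x - sc q t - rep r"
      have yT: "y \<in> T" using T_add[OF 1 neg[of "rep r"]] rep by (simp add: y_def)
      have "y = ((x - sc q t) - sc r s) - (rep r - sc r s)" by (simp add: y_def)
      then have yX: "y \<in> span X" using span_diff[OF 2, of "rep r - sc r s"] rep by (simp only:)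
      have "sc q t = sc (q mod e) t"
      proof -
        have "sc q t = sc (q div e * e + q mod e) t" by simp
        also have "\<dots> = sc (q mod e) t"
          unfolding scale_left_distrib by (simp add: e(2) flip: scale_scale)
        finally show ?thesis .
      qed
      then have "x = ?f (r, q mod e, y)" by (simp add: y_def)
      moreover have "r \<in> {- \<bar>k0\<bar>..\<bar>k0\<bar>}" "q mod e \<in> {- \<bar>e\<bar>..\<bar>e\<bar>}"
        using abs_mod_less[OF k0, of k] abs_mod_less[OF e(1), of q] by (auto simp: r_def)
      ultimately show "x \<in> ?f ` ({- \<bar>k0\<bar>..\<bar>k0\<bar>} \<times> {- \<bar>e\<bar>..\<bar>e\<bar>} \<times> (span X \<inter> T))"
        using yX yT by blast
    qed
    then show ?thesis by (rule finite_subset) (simp add: IH)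
  qed
qed

section \<open>Finitely presented extensions of an abelian group by the integers\<close>

definition sym_group :: "('x \<Rightarrow> 'x) monoid" where
  "sym_group = \<lparr>carrier = {f. bij f}, monoid.mult = (\<circ>), one = id\<rparr>"

lemma sym_group_simps [simp]:
  "f \<in> carrier sym_group \<longleftrightarrow> bij f"
  "f \<otimes>\<^bsub>sym_group\<^esub> g = f \<circ> g"
  "\<one>\<^bsub>sym_group\<^esub> = id"
  by (simp_all add: sym_group_def)

lemma group_sym_group: "group sym_group"
proof (rule groupI)
  fix f :: "'x \<Rightarrow> 'x" assume "f \<in> carrier sym_group"
  then have "bij f" by simp
  then have "bij (inv_into UNIV f)" "inv_into UNIV f \<circ> f = id"
    by (auto simp: bij_imp_bij_inv bij_is_inj)
  then show "\<exists>g\<in>carrier sym_group. g \<otimes>\<^bsub>sym_group\<^esub> f = \<one>\<^bsub>sym_group\<^esub>" by auto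
qed (auto intro: bij_comp)

text \<open>
  An action of the infinite cyclic group on an abelian group, written as a family indexed by the
  integers so that no generator has to be named. The scalar multiplication by integers is part of the
  data in order to have spans available for the subgroups generated by a set.
\<close>
locale int_action = Modules.module sc for sc :: "int \<Rightarrow> 'm::ab_group_add \<Rightarrow> 'm" +
  fixes act :: "int \<Rightarrow> 'm \<Rightarrow> 'm"
  assumes act_0 [simp]: "act 0 x = x"
    and act_act [simp]: "act j (act k x) = act (j + k) x"
    and act_add: "act k (x + y) = act k x + act k y"
begin

lemma act_zero [simp]: "act k 0 = 0"
  using act_add[of k 0 0] by simp

lemma act_minus: "act k (- x) = - act k x"
  using act_add[of k x "- x"] by (simp add: eq_neg_iff_add_eq_0 add.commute)

lemma act_scale: "act k (sc n x) = sc n (act k x)"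
proof -
  have pos: "act k (sc (int i) x) = sc (int i) (act k x)" for i
    by (induction i) (auto simp: scale_left_distrib act_add)
  show ?thesis
  proof (cases "n \<ge> 0")
    case True
    then show ?thesis using pos[of "nat n"] by simp
  next
    case False
    then have "sc n y = - sc (int (nat (- n))) y" for y by simp
    then show ?thesis using pos[of "nat (- n)"] by (metis act_minus)
  qed
qed

lemma act_eq_iff [simp]: "act k x = act k y \<longleftrightarrow> x = y"
proof
  assume "act k x = act k y"
  then have "act (- k) (act k x) = act (- k) (act k y)" by simp
  then show "x = y" by simp
qed simp

definition extension :: "('m \<times> int) monoid" where
  "extension = \<lparr>carrier = UNIV, monoid.mult = (\<lambda>(x, j) (y, k). (x + act j y, j + k)), one = (0, 0)\<rparr>"

lemma extension_simps [simp]: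
  "g \<in> carrier extension"
  "(x, j) \<otimes>\<^bsub>extension\<^esub> (y, k) = (x + act j y, j + k)"
  "\<one>\<^bsub>extension\<^esub> = (0, 0)"
  by (simp_all add: extension_def)

lemma group_extension: "group extension"
proof (rule groupI)
  fix g :: "'m \<times> int"
  obtain x k where g: "g = (x, k)" by (cases g)
  have "(- act (- k) x, - k) \<otimes>\<^bsub>extension\<^esub> g = \<one>\<^bsub>extension\<^esub>" by (simp add: g)
  then show "\<exists>h\<in>carrier extension. h \<otimes>\<^bsub>extension\<^esub> g = \<one>\<^bsub>extension\<^esub>"
    using extension_simps(1) by blast
qed (auto simp: act_add add.assoc)

lemma inv_extension: "inv\<^bsub>extension\<^esub> (x, k) = (- act (- k) x, - k)"
  by (rule group.inv_equality[OF group_extension]) simp_all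

definition transl :: "'m \<Rightarrow> 'm \<times> int \<Rightarrow> 'm \<times> int" where
  "transl b = (\<lambda>(x, i). (x + b, i))"

text \<open>
  The second coordinate records visits to \<open>A\<close>. The twist agrees with the action of the generator on
  the first coordinate, and the increment of the counter is constant on cosets of \<open>A\<close>; this makes the
  twist compatible with translations by elements of \<open>A\<close> but with few others.
\<close>
definition twist :: "'m set \<Rightarrow> 'm \<times> int \<Rightarrow> 'm \<times> int" where
  "twist A = (\<lambda>(x, i). (act 1 x, i + of_bool (act 1 x \<in> A)))"

definition twist_pow :: "'m set \<Rightarrow> int \<Rightarrow> 'm \<times> int \<Rightarrow> 'm \<times> int" where
  "twist_pow A k = twist A [^]\<^bsub>sym_group\<^esub> k"

lemma transl_add: "transl b \<circ> transl c = transl (b + c)"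
  by (auto simp: transl_def fun_eq_iff ac_simps)

lemma transl_0 [simp]: "transl 0 = id"
  by (auto simp: transl_def fun_eq_iff)

lemma bij_transl [simp]: "bij (transl b)"
  by (rule o_bij[of "transl (- b)"]) (simp_all add: transl_add)

lemma bij_twist [simp]: "bij (twist A)"
  by (rule o_bij[of "\<lambda>(y, i). (act (- 1) y, i - of_bool (y \<in> A))"])
    (auto simp: twist_def fun_eq_iff)

lemma twist_pow_simps [simp]:
  "bij (twist_pow A k)" "twist_pow A 0 = id" "twist_pow A 1 = twist A"
  "twist_pow A j \<circ> twist_pow A k = twist_pow A (j + k)"
proof -
  interpret group "sym_group :: ('m \<times> int \<Rightarrow> 'm \<times> int) monoid" by (rule group_sym_group)
  have "twist A [^]\<^bsub>sym_group\<^esub> l \<in> carrier sym_group" for l :: int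
    by (rule int_pow_closed) simp
  then show "bij (twist_pow A k)" by (simp add: twist_pow_def)
  show "twist_pow A 0 = id" by (simp add: twist_pow_def)
  show "twist_pow A 1 = twist A" by (simp add: twist_pow_def)
  have "twist A [^]\<^bsub>sym_group\<^esub> (j + k) = twist A [^]\<^bsub>sym_group\<^esub> j \<otimes>\<^bsub>sym_group\<^esub> twist A [^]\<^bsub>sym_group\<^esub> k"
    by (rule int_pow_mult) simp
  then show "twist_pow A j \<circ> twist_pow A k = twist_pow A (j + k)" by (simp add: twist_pow_def)
qed

lemma twist_transl:
  assumes "subspace A" "act 1 x \<in> A"
  shows "twist A \<circ> transl x = transl (act 1 x) \<circ> twist A"
proof -
  have "y + act 1 x \<in> A \<longleftrightarrow> y \<in> A" for y
    using assms subspace_add[OF assms(1), of y "act 1 x"]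
      subspace_diff[OF assms(1), of "y + act 1 x" "act 1 x"] by auto
  then show ?thesis by (auto simp: fun_eq_iff twist_def transl_def act_add)
qed

definition window :: "'m set \<Rightarrow> int \<Rightarrow> int \<Rightarrow> 'm set" where
  "window X a b = span {act k x | k x. x \<in> X \<and> a \<le> k \<and> k \<le> b}"

lemma subspace_window [simp]: "subspace (window X a b)"
  by (simp add: window_def)

lemma window_mono: "a' \<le> a \<Longrightarrow> b \<le> b' \<Longrightarrow> window X a b \<subseteq> window X a' b'"
  unfolding window_def by (intro span_mono) force

lemma window_base: "x \<in> X \<Longrightarrow> a \<le> k \<Longrightarrow> k \<le> b \<Longrightarrow> act k x \<in> window X a b"
  unfolding window_def by (intro span_base) blast

lemma window_subset_iff:
  assumes "subspace V"
  shows "window X a b \<subseteq> V \<longleftrightarrow> (\<forall>x\<in>X. \<forall>k\<in>{a..b}. act k x \<in> V)"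
proof
  assume "window X a b \<subseteq> V"
  then show "\<forall>x\<in>X. \<forall>k\<in>{a..b}. act k x \<in> V" using window_base by fastforce
next
  assume "\<forall>x\<in>X. \<forall>k\<in>{a..b}. act k x \<in> V"
  then show "window X a b \<subseteq> V"
    unfolding window_def by (intro span_minimal assms) auto
qed

lemma subspace_act_vimage: "subspace V \<Longrightarrow> subspace {x. act k x \<in> V}"
  by (auto simp: subspace_def act_add act_scale)

lemma act_window: "x \<in> window X a b \<Longrightarrow> act k x \<in> window X (a + k) (b + k)"
proof -
  have "window X a b \<subseteq> {x. act k x \<in> window X (a + k) (b + k)}"
    by (subst window_subset_iff) (auto intro: subspace_act_vimage window_base)
  then show "x \<in> window X a b \<Longrightarrow> ?thesis" by blast
qed

text \<open>
  Moving a translation past \<open>k\<close> twists, one twist at a time, only meets the elements \<open>act i x\<close> with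
  \<open>i\<close> between \<open>0\<close> and \<open>k\<close>. The window is asymmetric because a positive step applies
  \<open>twist_transl\<close> to the element before the step and needs its image in \<open>A\<close>, whereas a negative step
  applies it to the element after the step and needs the starting element in \<open>A\<close>.
\<close>
lemma twist_pow_transl:
  assumes x: "x \<in> window X (- j) j" and k: "\<bar>k\<bar> + j \<le> K"
  shows "twist_pow (window X (1 - K) K) k \<circ> transl x
    = transl (act k x) \<circ> twist_pow (window X (1 - K) K) k"
proof -
  let ?A = "window X (1 - K) K"
  have up: "twist_pow ?A (int n) \<circ> transl x = transl (act (int n) x) \<circ> twist_pow ?A (int n)"
    if "int n + j \<le> K" for n
    using that
  proof (induction n)
    case (Suc n)
    have "act 1 (act (int n) x) \<in> window X (- j + (int n + 1)) (j + (int n + 1))"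
      using act_window[OF x, of "int n + 1"] by (simp add: add.commute)
    also have "\<dots> \<subseteq> ?A" using Suc.prems by (intro window_mono) auto
    finally have A: "act 1 (act (int n) x) \<in> ?A" .
    have "twist_pow ?A (int (Suc n)) \<circ> transl x = twist ?A \<circ> (twist_pow ?A (int n) \<circ> transl x)"
      using twist_pow_simps(4)[of ?A 1 "int n"] by (simp add: o_assoc add.commute)
    also have "twist_pow ?A (int n) \<circ> transl x = transl (act (int n) x) \<circ> twist_pow ?A (int n)"
      by (rule Suc.IH) (use Suc.prems in simp)
    also have "twist ?A \<circ> \<dots> = (twist ?A \<circ> transl (act (int n) x)) \<circ> twist_pow ?A (int n)"
      by (simp only: o_assoc)
    also have "\<dots> = transl (act 1 (act (int n) x)) \<circ> (twist ?A \<circ> twist_pow ?A (int n))"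
      by (simp only: twist_transl[OF subspace_window A] o_assoc)
    also have "twist ?A \<circ> twist_pow ?A (int n) = twist_pow ?A (int (Suc n))"
      using twist_pow_simps(4)[of ?A 1 "int n"] by simp
    finally show ?case by (simp add: add.commute)
  qed simp
  have down: "twist_pow ?A (- int n) \<circ> transl x = transl (act (- int n) x) \<circ> twist_pow ?A (- int n)"
    if "int n + j \<le> K" for n
    using that
  proof (induction n)
    case (Suc n)
    let ?y = "act (- int (Suc n)) x"
    have "act 1 ?y \<in> window X (- j + - int n) (j + - int n)"
      using act_window[OF x, of "- int n"] by simp
    also have "\<dots> \<subseteq> ?A" using Suc.prems by (intro window_mono) auto
    finally have A: "act 1 ?y \<in> ?A" .
    have pow: "twist_pow ?A (- 1) \<circ> twist_pow ?A (- int n) = twist_pow ?A (- int (Suc n))"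
      by simp
    have inv: "twist_pow ?A (- 1) \<circ> twist ?A = id" "twist ?A \<circ> twist_pow ?A (- 1) = id"
      using twist_pow_simps(4)[of ?A "- 1" 1] twist_pow_simps(4)[of ?A 1 "- 1"] by simp_all
    have *: "twist_pow ?A (- 1) \<circ> transl (act 1 ?y) = transl ?y \<circ> twist_pow ?A (- 1)"
    proof -
      have "twist_pow ?A (- 1) \<circ> transl (act 1 ?y)
          = twist_pow ?A (- 1) \<circ> (transl (act 1 ?y) \<circ> twist ?A) \<circ> twist_pow ?A (- 1)"
        by (simp add: comp_assoc inv)
      also have "\<dots> = twist_pow ?A (- 1) \<circ> (twist ?A \<circ> transl ?y) \<circ> twist_pow ?A (- 1)"
        by (simp only: twist_transl[OF subspace_window A])
      also have "\<dots> = (twist_pow ?A (- 1) \<circ> twist ?A) \<circ> transl ?y \<circ> twist_pow ?A (- 1)"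
        by (simp only: o_assoc)
      finally show ?thesis by (simp add: inv)
    qed
    have "twist_pow ?A (- int (Suc n)) \<circ> transl x
        = twist_pow ?A (- 1) \<circ> (twist_pow ?A (- int n) \<circ> transl x)"
      by (simp only: pow[symmetric] o_assoc)
    also have "twist_pow ?A (- int n) \<circ> transl x = transl (act (- int n) x) \<circ> twist_pow ?A (- int n)"
      by (rule Suc.IH) (use Suc.prems in simp)
    also have "act (- int n) x = act 1 ?y" by simp
    also have "twist_pow ?A (- 1) \<circ> (transl (act 1 ?y) \<circ> twist_pow ?A (- int n))
        = transl ?y \<circ> (twist_pow ?A (- 1) \<circ> twist_pow ?A (- int n))"
      by (simp only: * o_assoc)
    finally show ?case by (simp only: pow)
  qed simp
  show ?thesis
  proof (cases "k \<ge> 0")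
    case True
    then show ?thesis using up[of "nat k"] k by simp
  next
    case False
    then show ?thesis using down[of "nat (- k)"] k by simp
  qed
qed

text \<open>
  Each letter changes the exponent by at most \<open>L\<close> and adds a summand shifted by the exponent reached
  so far, so everything that occurs in a word of length \<open>n\<close> stays within distance \<open>L n\<close>.
\<close>
lemma word_value_extension_window:
  assumes \<gamma>: "\<And>a. a \<in> S \<Longrightarrow> \<bar>snd (\<gamma> a)\<bar> \<le> L" and "set w \<subseteq> S \<times> UNIV"
  shows "fst (word_value extension \<gamma> w) \<in> window (fst ` \<gamma> ` S) (- (L * int (length w))) (L * int (length w))"
    and "\<bar>snd (word_value extension \<gamma> w)\<bar> \<le> L * int (length w)"
proof -
  let ?W = "\<lambda>n. window (fst ` \<gamma> ` S) (- (L * int n)) (L * int n)"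
  have letter: "fst (letter_value extension \<gamma> l) \<in> ?W 1 \<and> \<bar>snd (letter_value extension \<gamma> l)\<bar> \<le> L"
    if l: "fst l \<in> S" for l
  proof -
    obtain y d where yd: "\<gamma> (fst l) = (y, d)" by (cases "\<gamma> (fst l)")
    have y: "y \<in> fst ` \<gamma> ` S" using l yd by force
    have d: "\<bar>d\<bar> \<le> L" using \<gamma>[OF l] yd by simp
    have "act 0 y \<in> ?W 1" "act (- d) y \<in> ?W 1"
      using d window_base[OF y, of "- L" 0 L] window_base[OF y, of "- L" "- d" L] by auto
    then show ?thesis
      using d by (auto simp: letter_value_def yd inv_extension intro: subspace_neg)
  qed
  have "fst (word_value extension \<gamma> w) \<in> ?W (length w) \<and>
      \<bar>snd (word_value extension \<gamma> w)\<bar> \<le> L * int (length w)"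
    using assms(2)
  proof (induction w)
    case Nil
    then show ?case by (simp add: subspace_0)
  next
    case (Cons l w)
    obtain y d where yd: "letter_value extension \<gamma> l = (y, d)" by (cases "letter_value extension \<gamma> l")
    obtain x e where xe: "word_value extension \<gamma> w = (x, e)" by (cases "word_value extension \<gamma> w")
    have d: "\<bar>d\<bar> \<le> L" and y: "y \<in> ?W 1"
      using letter[of l] Cons.prems yd by auto
    have e: "\<bar>e\<bar> \<le> L * int (length w)" and x: "x \<in> ?W (length w)"
      using Cons xe by auto
    have L: "L * int (Suc (length w)) = L + L * int (length w)" by (simp add: algebra_simps)
    have "y \<in> ?W (Suc (length w))"
      by (rule subsetD[OF window_mono y]) (use d e L in auto)
    moreover have "act d x \<in> ?W (Suc (length w))"
      by (rule subsetD[OF window_mono act_window[OF x, of d]]) (use d L in auto)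
    ultimately have "y + act d x \<in> ?W (Suc (length w))"
      by (intro subspace_add) auto
    moreover have "\<bar>d + e\<bar> \<le> L * int (Suc (length w))" using d e L by simp
    ultimately show ?case by (simp add: yd xe)
  qed
  then show "fst (word_value extension \<gamma> w) \<in> ?W (length w)"
    and "\<bar>snd (word_value extension \<gamma> w)\<bar> \<le> L * int (length w)" by auto
qed

lemma twist_pow_cancel: "f \<circ> twist_pow A k = g \<circ> twist_pow A k \<longleftrightarrow> f = g"
proof
  assume eq: "f \<circ> twist_pow A k = g \<circ> twist_pow A k"
  show "f = g"
  proof
    fix p
    obtain q where "p = twist_pow A k q"
      using bij_is_surj[OF twist_pow_simps(1)[of A k]] by (metis surjD)
    then show "f p = g p" using eq by (metis comp_apply)
  qed
qed simp

text \<open>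
  The map \<open>P\<close> is not a homomorphism on the whole extension, but it is multiplicative as long as the
  exponents involved stay inside the window. Hence a word that is short compared with the window has
  the same value whether it is evaluated before or after applying \<open>P\<close>.
\<close>
lemma word_value_sym_group:
  fixes \<gamma> :: "'a \<Rightarrow> 'm \<times> int" and S K
  defines "A \<equiv> window (fst ` \<gamma> ` S) (1 - K) K"
  defines "P \<equiv> \<lambda>g. transl (fst g) \<circ> twist_pow A (snd g)"
  assumes \<gamma>: "\<And>a. a \<in> S \<Longrightarrow> \<bar>snd (\<gamma> a)\<bar> \<le> L" and w: "set w \<subseteq> S \<times> UNIV"
    and K: "L * int (length w) \<le> K"
  shows "word_value sym_group (\<lambda>a. P (\<gamma> a)) w = P (word_value extension \<gamma> w)"
proof -
  let ?W = "\<lambda>n. window (fst ` \<gamma> ` S) (- (L * int n)) (L * int n)"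
  have letter: "letter_value sym_group (\<lambda>a. P (\<gamma> a)) l = P (letter_value extension \<gamma> l)"
    if l: "fst l \<in> S" and L: "L \<le> K" for l
  proof (cases "snd l")
    case True
    then show ?thesis by (simp add: letter_value_def)
  next
    case False
    interpret sym: group "sym_group :: ('m \<times> int \<Rightarrow> 'm \<times> int) monoid" by (rule group_sym_group)
    obtain y d where yd: "\<gamma> (fst l) = (y, d)" by (cases "\<gamma> (fst l)")
    have d: "\<bar>d\<bar> + 0 \<le> K" using \<gamma>[OF l] yd L by simp
    have "act 0 (- y) \<in> window (fst ` \<gamma> ` S) (- 0) 0"
      unfolding act_minus by (intro subspace_neg[OF subspace_window] window_base) (use l yd in force)+
    then have y: "- y \<in> window (fst ` \<gamma> ` S) (- 0) 0" by simp
    have "P (- act (- d) y, - d) = transl (act (- d) (- y)) \<circ> twist_pow A (- d)"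
      by (simp add: P_def act_minus)
    also have "\<dots> = twist_pow A (- d) \<circ> transl (- y)"
      unfolding A_def by (rule twist_pow_transl[OF y, symmetric]) (use d in simp)
    finally have "P (- act (- d) y, - d) \<circ> P (y, d)
        = twist_pow A (- d) \<circ> (transl (- y) \<circ> transl y) \<circ> twist_pow A d"
      by (simp add: P_def o_assoc)
    then have "P (- act (- d) y, - d) \<circ> P (y, d) = id" by (simp add: transl_add)
    then have "inv\<^bsub>sym_group\<^esub> P (y, d) = P (- act (- d) y, - d)"
      by (intro sym.inv_equality) (auto simp: P_def intro: bij_comp)
    with False show ?thesis by (simp add: letter_value_def yd inv_extension)
  qed
  show ?thesis
    using w K
  proof (induction w)
    case Nil
    then show ?case by (simp add: P_def)
  next
    case (Cons l w)
    obtain y d where yd: "letter_value extension \<gamma> l = (y, d)" by (cases "letter_value extension \<gamma> l")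
    obtain x e where xe: "word_value extension \<gamma> w = (x, e)" by (cases "word_value extension \<gamma> w")
    have l: "fst l \<in> S" using Cons.prems by auto
    have LK: "L + L * int (length w) \<le> K" using Cons.prems(2) by (simp add: algebra_simps)
    have "0 \<le> L" using \<gamma>[OF l] by simp
    then have L0: "0 \<le> L * int (length w)" by simp
    have "\<bar>snd (word_value extension \<gamma> [l])\<bar> \<le> L * int (length [l])"
      by (rule word_value_extension_window(2)[where \<gamma> = \<gamma>, OF \<gamma>]) (use l in \<open>auto simp: mem_Times_iff\<close>)
    then have d: "\<bar>d\<bar> \<le> L" by (simp add: yd)
    have "set w \<subseteq> S \<times> UNIV" using Cons.prems by auto
    from word_value_extension_window(1)[where \<gamma> = \<gamma>, OF \<gamma> this] have x: "x \<in> ?W (length w)"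
      by (simp add: xe)
    have "word_value sym_group (\<lambda>a. P (\<gamma> a)) (l # w) = P (y, d) \<circ> P (x, e)"
      using Cons letter[OF l] LK \<open>0 \<le> L\<close> L0 by (simp add: yd xe)
    also have "\<dots> = transl y \<circ> (twist_pow A d \<circ> transl x) \<circ> twist_pow A e"
      by (simp add: P_def o_assoc)
    also have "twist_pow A d \<circ> transl x = transl (act d x) \<circ> twist_pow A d"
      unfolding A_def by (rule twist_pow_transl[OF x]) (use d LK in simp)
    also have "transl y \<circ> (transl (act d x) \<circ> twist_pow A d) \<circ> twist_pow A e
        = (transl y \<circ> transl (act d x)) \<circ> (twist_pow A d \<circ> twist_pow A e)"
      by (simp only: o_assoc)
    also have "\<dots> = P (word_value extension \<gamma> (l # w))"
      by (simp add: transl_add yd xe P_def)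
    finally show ?case .
  qed
qed

text \<open>
  If neither element lies in \<open>A\<close>, the counter at the point \<open>(0, 0)\<close> tells the two orders of
  composition apart. Applying \<open>P = twist A \<circ> transl y \<circ> (twist A)\<inverse>\<close> there first undoes the visit of \<open>0\<close>
  to \<open>A\<close>, which lowers the counter, and the final twist does not restore it since \<open>act 1 y \<notin> A\<close>.
  At the translated point \<open>(x, 0)\<close> with \<open>x \<notin> A\<close> there is no visit to undo.
\<close>
lemma transl_twist_commute_imp:
  assumes A: "subspace A" and P: "P \<circ> twist A = twist A \<circ> transl y"
    and comm: "P \<circ> transl x = transl x \<circ> P"
  shows "x \<in> A \<or> act 1 y \<in> A"
proof (rule ccontr)
  assume "\<not> ?thesis"
  then have x: "x \<notin> A" and y: "act 1 y \<notin> A" by auto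
  have "0 \<in> A" by (rule subspace_0[OF A])
  have P': "P (twist A p) = twist A (transl y p)" for p
    using P by (metis comp_apply)
  have "P (0, 0) = P (twist A (0, - 1))" using \<open>0 \<in> A\<close> by (simp add: twist_def)
  also have "\<dots> = (act 1 y, - 1)" unfolding P' using y by (simp add: twist_def transl_def)
  finally have 1: "transl x (P (0, 0)) = (act 1 y + x, - 1)" by (simp add: transl_def)
  have "P (x, 0) = P (twist A (act (- 1) x, 0))" using x by (simp add: twist_def)
  also have "\<dots> = twist A (act (- 1) x + y, 0)" unfolding P' by (simp add: transl_def)
  finally have "snd (P (x, 0)) \<ge> 0" by (simp add: twist_def)
  moreover have "P (x, 0) = P (transl x (0, 0))" by (simp add: transl_def)
  ultimately show False using 1 comm by (metis comp_apply snd_conv neg_0_le_iff_le not_one_le_zero)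
qed

text \<open>
  The set \<open>X\<close> consists of the first coordinates of the generators in a finite presentation. The
  constant \<open>K\<close> is chosen so large that the permutation representation kills the relators and sends
  a chosen word for \<open>(0, 1)\<close> to the twist. In the resulting representation of the extension the
  elements \<open>act (- K) x\<close> and \<open>act (K + 1) y\<close> still commute, although they lie just outside the
  window, and this forces one of them into its span.
\<close>
theorem finitely_presented_extension_dichotomy:
  assumes "finitely_presented extension"
  obtains X K where "finite X" "K \<ge> 1" "\<And>x. \<exists>n. x \<in> window X (- n) n"
    "(\<forall>x\<in>X. act (- K) x \<in> window X (1 - K) K) \<or> (\<forall>x\<in>X. act (K + 1) x \<in> window X (1 - K) K)"
proof -
  interpret E: group extension by (rule group_extension)
  interpret sym: group "sym_group :: ('m \<times> int \<Rightarrow> 'm \<times> int) monoid" by (rule group_sym_group)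
  from E.finitely_presentedE[OF assms] obtain n R \<phi> where R: "finite R"
      "R \<subseteq> carrier (free_group {..<n::nat})"
    and \<phi>: "\<phi> \<in> hom (free_group {..<n}) extension"
      "\<phi> ` carrier (free_group {..<n}) = carrier extension"
    and ker: "kernel (free_group {..<n}) extension \<phi> = normal_closure (free_group {..<n}) R"
    by metis
  define \<gamma> where "\<gamma> a = \<phi> [(a, True)]" for a
  define X where "X = fst ` \<gamma> ` {..<n}"
  define L where "L = (\<Sum>a<n. \<bar>snd (\<gamma> a)\<bar>)"
  have L: "\<bar>snd (\<gamma> a)\<bar> \<le> L" if "a \<in> {..<n}" for a
    unfolding L_def by (rule member_le_sum[OF that]) auto
  have "0 \<le> L" unfolding L_def by (rule sum_nonneg) simp
  have \<phi>_word: "\<phi> w = word_value extension \<gamma> w" if "w \<in> carrier (free_group {..<n})" for w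
    unfolding \<gamma>_def by (rule E.hom_eq_word_value[OF \<phi>(1) that])
  have "(0, 1) \<in> \<phi> ` carrier (free_group {..<n})" by (simp add: \<phi>(2))
  then obtain u where u: "u \<in> carrier (free_group {..<n})" "\<phi> u = (0, 1)" by force
  \<comment> \<open>The summand \<open>L + 1\<close> ensures that single letters fit into the window and that \<open>K\<close> is positive.\<close>
  define K where "K = L * int (Max (length ` insert u R)) + L + 1"
  have K: "K \<ge> 1" "L \<le> K" using \<open>0 \<le> L\<close> by (simp_all add: K_def)
  have len: "L * int (length w) \<le> K" if "w \<in> insert u R" for w
  proof -
    have "length w \<le> Max (length ` insert u R)" using that R(1) by (intro Max_ge) auto
    then have "L * int (length w) \<le> L * int (Max (length ` insert u R))"
      using \<open>0 \<le> L\<close> by (intro mult_left_mono) auto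
    then show ?thesis using \<open>0 \<le> L\<close> by (simp add: K_def)
  qed
  define A where "A = window X (1 - K) K"
  define P where "P g = transl (fst g) \<circ> twist_pow A (snd g)" for g
  define \<psi> where "\<psi> = word_value sym_group (\<lambda>a. P (\<gamma> a))"
  have \<psi>: "\<psi> \<in> hom (free_group {..<n}) sym_group"
    unfolding \<psi>_def by (rule sym.word_value_hom) (simp add: P_def bij_comp)
  have set: "set w \<subseteq> {..<n} \<times> UNIV" if "w \<in> carrier (free_group {..<n})" for w
    using that by (simp add: free_group_def)
  have \<psi>_P: "\<psi> w = P (\<phi> w)" if "w \<in> insert u R" for w
  proof -
    have w: "w \<in> carrier (free_group {..<n})" using that u R by auto
    show ?thesis
      unfolding \<psi>_def P_def A_def X_def \<phi>_word[OF w]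
      by (rule word_value_sym_group[OF L set[OF w] len[OF that]])
  qed
  have "\<psi> r = \<one>\<^bsub>sym_group\<^esub>" if "r \<in> R" for r
  proof -
    have "R \<subseteq> kernel (free_group {..<n}) extension \<phi>"
      unfolding ker using R(2) by (intro subset_normal_closure group_free_group)
    then have "\<phi> r = (0, 0)" using that by (auto simp: kernel_def)
    then show ?thesis using \<psi>_P[of r] that by (simp add: P_def)
  qed
  from E.von_Dyck[OF group_free_group \<phi> ker R(2) sym.is_group \<psi> this]
  obtain \<Psi> where \<Psi>: "\<Psi> \<in> hom extension sym_group"
    and \<Psi>_\<phi>: "\<And>w. w \<in> carrier (free_group {..<n}) \<Longrightarrow> \<Psi> (\<phi> w) = \<psi> w"
    by metis
  interpret \<Psi>: group_hom extension sym_group \<Psi>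
    using \<Psi> by (simp add: group_hom_def group_hom_axioms_def E.is_group sym.is_group)
  have mult: "\<Psi> (x + act j y, j + k) = \<Psi> (x, j) \<circ> \<Psi> (y, k)" for x y j k
    using \<Psi>.hom_mult[of "(x, j)" "(y, k)"] by simp
  have "\<Psi> (0, 1) = twist A"
    using \<Psi>_\<phi>[OF u(1)] \<psi>_P[of u] u(2) by (simp add: P_def)
  moreover have "(0, 1) [^]\<^bsub>extension\<^esub> k = (0, k)" for k :: int
  proof (induction k rule: int_induct[where k = 0])
    case (step1 i)
    then show ?case using E.int_pow_mult[of "(0, 1)" i 1] by simp
  next
    case (step2 i)
    then show ?case using E.int_pow_mult[of "(0, 1)" i "- 1"] by (simp add: E.int_pow_neg inv_extension)
  qed simp
  ultimately have shift: "\<Psi> (0, k) = twist_pow A k" for k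
    using \<Psi>.hom_int_pow[of "(0, 1)" k] by (simp add: twist_pow_def)
  have X: "\<Psi> (x, 0) = transl x" if x: "x \<in> X" for x
  proof -
    from x obtain a where a: "a < n" "x = fst (\<gamma> a)" by (auto simp: X_def)
    then have g: "\<gamma> a = (x, snd (\<gamma> a))" by simp
    have w: "[(a, True)] \<in> carrier (free_group {..<n})"
      using a(1) by (intro singleton_in_free_group) simp
    have "\<Psi> (x, snd (\<gamma> a)) = \<psi> [(a, True)]"
      using \<Psi>_\<phi>[OF w] by (simp only: \<gamma>_def[symmetric] g[symmetric])
    also have "\<dots> = P (\<gamma> a)" by (simp add: \<psi>_def letter_value_def)
    also have "\<dots> = transl x \<circ> twist_pow A (snd (\<gamma> a))" by (simp add: P_def a(2))
    finally have "\<Psi> (x, 0) \<circ> twist_pow A (snd (\<gamma> a)) = transl x \<circ> twist_pow A (snd (\<gamma> a))"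
      using mult[of x 0 0 "snd (\<gamma> a)"] by (simp add: shift)
    then show ?thesis by (simp only: twist_pow_cancel)
  qed
  \<comment> \<open>Conjugation by \<open>(0, k)\<close> is the action of \<open>k\<close>; the same relation for twists and translations is only available inside the window.\<close>
  have swap: "\<Psi> (act k y, 0) \<circ> twist_pow A k = twist_pow A k \<circ> \<Psi> (y, 0)" for k y
    using mult[of "act k y" 0 0 k] mult[of 0 k y 0] by (simp add: shift)
  have act_X: "\<Psi> (act k x, 0) = transl (act k x)" if x: "x \<in> X" and k: "\<bar>k\<bar> \<le> K" for k x
  proof -
    have "act 0 x \<in> window X (- 0) 0" using x by (intro window_base) auto
    then have "x \<in> window X (- 0) 0" by simp
    then have "twist_pow A k \<circ> transl x = transl (act k x) \<circ> twist_pow A k"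
      unfolding A_def by (rule twist_pow_transl) (use k in simp)
    then have "\<Psi> (act k x, 0) \<circ> twist_pow A k = transl (act k x) \<circ> twist_pow A k"
      by (simp only: swap X[OF x])
    then show ?thesis by (simp only: twist_pow_cancel)
  qed
  have "act (- K) x \<in> A \<or> act (K + 1) y \<in> A" if "x \<in> X" "y \<in> X" for x y
  proof -
    have A: "subspace A" by (simp add: A_def)
    \<comment> \<open>The exponent \<open>K + 1\<close> is beyond the reach of \<open>act_X\<close>, so the image of this element is only known as a conjugate.\<close>
    have 1: "\<Psi> (act 1 (act K y), 0) \<circ> twist A = twist A \<circ> transl (act K y)"
      using swap[of 1 "act K y"] act_X[OF that(2), of K] K by simp
    have "\<Psi> (act 1 (act K y), 0) \<circ> \<Psi> (act (- K) x, 0) = \<Psi> (act (- K) x, 0) \<circ> \<Psi> (act 1 (act K y), 0)"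
      using mult[of "act 1 (act K y)" 0 "act (- K) x" 0] mult[of "act (- K) x" 0 "act 1 (act K y)" 0]
      by (simp add: add.commute)
    moreover have "\<Psi> (act (- K) x, 0) = transl (act (- K) x)"
      using act_X[OF that(1), of "- K"] K by simp
    ultimately show ?thesis
      using transl_twist_commute_imp[OF A 1, of "act (- K) x"] by (simp add: add.commute)
  qed
  then have "(\<forall>x\<in>X. act (- K) x \<in> A) \<or> (\<forall>x\<in>X. act (K + 1) x \<in> A)" by blast
  moreover have "\<exists>k. x \<in> window X (- k) k" for x
  proof -
    have "(x, 0) \<in> \<phi> ` carrier (free_group {..<n})" by (simp add: \<phi>(2))
    then obtain w where w: "w \<in> carrier (free_group {..<n})" "\<phi> w = (x, 0)" by force
    then show ?thesis
      using word_value_extension_window(1)[where \<gamma> = \<gamma>, OF L set[OF w(1)]] \<phi>_word[OF w(1)] by (auto simp: X_def)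
  qed
  moreover have "finite X" by (simp add: X_def)
  ultimately show ?thesis using that[of X K] K by (simp add: A_def)
qed

text \<open>
  If all generators just outside one end of the window lie in its span \<open>A\<close>, then \<open>A\<close> is stable under
  the action in that direction \<open>\<epsilon>\<close>, and moving any element far enough in that direction brings it
  into \<open>A\<close>.
\<close>
theorem finitely_presented_extension_ascending:
  assumes "finitely_presented extension"
  obtains Y \<epsilon> where "finite Y" "\<And>y. y \<in> span Y \<Longrightarrow> act \<epsilon> y \<in> span Y"
    "\<And>x. \<exists>n::nat. act (\<epsilon> * int n) x \<in> span Y"
proof -
  from finitely_presented_extension_dichotomy[OF assms] obtain X K where X: "finite X" "K \<ge> 1"
    and exhaust: "\<And>x. \<exists>n. x \<in> window X (- n) n"
    and dich: "(\<forall>x\<in>X. act (- K) x \<in> window X (1 - K) K) \<or>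
      (\<forall>x\<in>X. act (K + 1) x \<in> window X (1 - K) K)" by metis
  define A where "A = window X (1 - K) K"
  define Y where "Y = (\<lambda>(k, x). act k x) ` ({1 - K..K} \<times> X)"
  have A_Y: "A = span Y" unfolding A_def Y_def window_def by (rule arg_cong[of _ _ span]) force
  have A: "subspace A" by (simp add: A_def)
  obtain \<epsilon> where \<epsilon>: "\<epsilon> = 1 \<or> \<epsilon> = - 1" and inv: "\<And>y. y \<in> A \<Longrightarrow> act \<epsilon> y \<in> A"
  proof -
    have "A \<subseteq> {y. act \<epsilon> y \<in> A}"
      if *: "\<And>k x. x \<in> X \<Longrightarrow> k \<in> {1 - K..K} \<Longrightarrow> k + \<epsilon> \<notin> {1 - K..K} \<Longrightarrow> act (k + \<epsilon>) x \<in> A" for \<epsilon>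
    proof -
      have "act (k + \<epsilon>) x \<in> A" if "x \<in> X" "k \<in> {1 - K..K}" for k x
        using *[OF that] window_base[OF that(1), of "1 - K" "k + \<epsilon>" K] by (auto simp: A_def)
      then show ?thesis
        using window_subset_iff[OF subspace_act_vimage[OF A, of \<epsilon>], of X "1 - K" K]
        by (simp add: add.commute flip: A_def)
    qed
    note inv = this
    from dich show ?thesis
    proof
      assume d: "\<forall>x\<in>X. act (- K) x \<in> window X (1 - K) K"
      have "A \<subseteq> {y. act (- 1) y \<in> A}"
      proof (rule inv)
        fix k x assume "x \<in> X" "k \<in> {1 - K..K}" "k + - 1 \<notin> {1 - K..K}"
        moreover from this have "k + - 1 = - K" by auto
        ultimately show "act (k + - 1) x \<in> A" using d by (simp add: A_def)
      qed
      then show ?thesis using that[of "- 1"] by auto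
    next
      assume d: "\<forall>x\<in>X. act (K + 1) x \<in> window X (1 - K) K"
      have "A \<subseteq> {y. act 1 y \<in> A}"
      proof (rule inv)
        fix k x assume "x \<in> X" "k \<in> {1 - K..K}" "k + 1 \<notin> {1 - K..K}"
        moreover from this have "k + 1 = K + 1" by auto
        ultimately show "act (k + 1) x \<in> A" using d by (simp add: A_def)
      qed
      then show ?thesis using that[of 1] by auto
    qed
  qed
  have iter: "act (\<epsilon> * int n) y \<in> A" if "y \<in> A" for n y
  proof (induction n)
    case (Suc n)
    have "act \<epsilon> (act (\<epsilon> * int n) y) \<in> A" by (rule inv[OF Suc])
    then show ?case by (simp add: algebra_simps)
  qed (simp add: that)
  have "\<exists>m::nat. act (\<epsilon> * int m) x \<in> A" for x
  proof -
    obtain n where n: "x \<in> window X (- n) n" using exhaust by blast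
    have "window X (- n) n \<subseteq> {x. act (\<epsilon> * int (nat n)) x \<in> A}"
    proof (subst window_subset_iff, intro subspace_act_vimage A, intro ballI)
      fix x k assume x: "x \<in> X" and k: "k \<in> {- n..n}"
      have "act 0 x \<in> A" unfolding A_def using x X(2) by (intro window_base) auto
      then have "x \<in> A" by simp
      then have "act (\<epsilon> * int (nat (n + \<epsilon> * k))) x \<in> A" by (rule iter)
      \<comment> \<open>Since \<open>\<epsilon>\<close> squares to \<open>1\<close>, moving \<open>act k x\<close> by \<open>\<epsilon> n\<close> amounts to moving \<open>x\<close> by \<open>\<epsilon> (n + \<epsilon> k)\<close>, a step in the stable direction.\<close>
      moreover have "\<epsilon> * int (nat (n + \<epsilon> * k)) = \<epsilon> * int (nat n) + k" using \<epsilon> k by auto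
      ultimately show "x \<in> X \<Longrightarrow> act k x \<in> {x. act (\<epsilon> * int (nat n)) x \<in> A}" by simp
    qed
    then show ?thesis using n by blast
  qed
  then show ?thesis using that[of Y \<epsilon>] X(1) inv by (simp add: A_Y Y_def)
qed

text \<open>
  Finitely many torsion elements can be moved into \<open>span Y\<close> by one common power of the action, which
  is injective and preserves torsion. Hence their number is at most that of the torsion elements of
  the finitely generated group \<open>span Y\<close>.
\<close>
theorem finite_torsion:
  assumes "finitely_presented extension"
  shows "finite {x. \<exists>n\<noteq>0. sc n x = 0}"
proof (rule ccontr)
  let ?T = "{x. \<exists>n\<noteq>0. sc n x = 0}"
  assume inf: "infinite ?T"
  obtain Y \<epsilon> where Y: "finite Y" and inv: "\<And>y. y \<in> span Y \<Longrightarrow> act \<epsilon> y \<in> span Y"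
    and ex: "\<And>x. \<exists>n::nat. act (\<epsilon> * int n) x \<in> span Y"
    using finitely_presented_extension_ascending[OF assms] by metis
  let ?TY = "{x \<in> span Y. \<exists>n\<noteq>0. sc n x = 0}"
  have fin: "finite ?TY" by (rule finite_torsion_span[OF module_axioms Y])
  obtain F where F: "F \<subseteq> ?T" "finite F" "card F = Suc (card ?TY)"
    using infinite_arbitrarily_large[OF inf] by blast
  obtain e where e: "\<And>x. act (\<epsilon> * int (e x)) x \<in> span Y" using ex by metis
  define N where "N = Max (e ` F)"
  have iter: "act (\<epsilon> * int n) y \<in> span Y" if "y \<in> span Y" for n y
  proof (induction n)
    case (Suc n)
    have "act \<epsilon> (act (\<epsilon> * int n) y) \<in> span Y" by (rule inv[OF Suc])
    then show ?case by (simp add: algebra_simps)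
  qed (simp add: that)
  have "act (\<epsilon> * int N) ` F \<subseteq> ?TY"
  proof (intro image_subsetI CollectI conjI)
    fix x assume x: "x \<in> F"
    have "e x \<le> N" unfolding N_def using F(2) x by simp
    then have "int N = int (N - e x) + int (e x)" by simp
    then have "act (\<epsilon> * int N) x = act (\<epsilon> * int (N - e x)) (act (\<epsilon> * int (e x)) x)"
      by (metis act_act distrib_left)
    then show "act (\<epsilon> * int N) x \<in> span Y" using iter[OF e] by simp
    from x F(1) obtain n where n: "n \<noteq> 0" "sc n x = 0" by auto
    then have "sc n (act (\<epsilon> * int N) x) = 0" by (simp flip: act_scale)
    with n(1) show "\<exists>n\<noteq>0. sc n (act (\<epsilon> * int N) x) = 0" by blast
  qed
  then have "card (act (\<epsilon> * int N) ` F) \<le> card ?TY" by (rule card_mono[OF fin])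
  moreover have "card (act (\<epsilon> * int N) ` F) = card F" by (rule card_image) (auto simp: inj_on_def)
  ultimately show False using F(3) by simp
qed

end

section \<open>The kernel of the map to the rationalisation\<close>

definition lin_ext :: "(int \<Rightarrow> 'm::ab_group_add \<Rightarrow> 'm) \<Rightarrow> ('k \<Rightarrow> 'm) \<Rightarrow> ('k \<Rightarrow>\<^sub>0 int) \<Rightarrow> 'm" where
  "lin_ext sc g z = (\<Sum>k\<in>Poly_Mapping.keys z. sc (Poly_Mapping.lookup z k) (g k))"

context
  fixes sc :: "int \<Rightarrow> 'm::ab_group_add \<Rightarrow> 'm"
  assumes module: "Modules.module sc"
begin

interpretation Modules.module sc by (rule module)

lemma lin_ext_superset:
  assumes "finite K" "Poly_Mapping.keys z \<subseteq> K"
  shows "lin_ext sc g z = (\<Sum>k\<in>K. sc (Poly_Mapping.lookup z k) (g k))"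
  unfolding lin_ext_def using assms by (intro sum.mono_neutral_left) (auto simp: in_keys_iff)

lemma lin_ext_add: "lin_ext sc g (x + y) = lin_ext sc g x + lin_ext sc g y"
proof -
  let ?K = "Poly_Mapping.keys x \<union> Poly_Mapping.keys y"
  have "lin_ext sc g (x + y) = (\<Sum>k\<in>?K. sc (Poly_Mapping.lookup (x + y) k) (g k))"
    by (rule lin_ext_superset) (auto simp: keys_add)
  also have "\<dots> = (\<Sum>k\<in>?K. sc (Poly_Mapping.lookup x k) (g k)) + (\<Sum>k\<in>?K. sc (Poly_Mapping.lookup y k) (g k))"
    by (simp add: lookup_add scale_left_distrib sum.distrib)
  also have "\<dots> = lin_ext sc g x + lin_ext sc g y"
    using lin_ext_superset[of ?K x g] lin_ext_superset[of ?K y g] by simp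
  finally show ?thesis .
qed

lemma lin_ext_cmul: "lin_ext sc g (frag_cmul c x) = sc c (lin_ext sc g x)"
proof -
  have "lin_ext sc g (frag_cmul c x)
      = (\<Sum>k\<in>Poly_Mapping.keys x. sc (Poly_Mapping.lookup (frag_cmul c x) k) (g k))"
    by (rule lin_ext_superset) (auto simp: keys_cmul)
  then show ?thesis by (simp add: lin_ext_def scale_sum_right)
qed

lemma lin_ext_frag_of: "lin_ext sc g (frag_of k) = g k"
  by (simp add: lin_ext_def)

lemma lin_ext_diff: "lin_ext sc g (x - y) = lin_ext sc g x - lin_ext sc g y"
  using lin_ext_add[of g "x - y" y] by simp

text \<open>
  The homomorphism \<open>a \<otimes> q \<mapsto> N q a\<close> makes sense only for \<open>q\<close> with denominator dividing \<open>N\<close>. The floor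
  extends it to all pairs \<open>(a, q)\<close> without being additive in \<open>q\<close>; additivity holds for a given
  relation once \<open>N\<close> is divisible by a denominator occurring in it. A single element of the span uses
  only finitely many relations, and a common multiple serves all of them.
\<close>
lemma lin_ext_tensor_relations:
  assumes "z \<in> tensor_relations"
  shows "\<exists>N>0. \<forall>N'. N dvd N' \<longrightarrow>
    lin_ext sc (\<lambda>(a, q :: rat). sc \<lfloor>of_int N' * q\<rfloor> a) z = 0"
  using assms unfolding tensor_relations_def
proof (induction rule: module.span_induct_alt[OF module_frag_cmul, consumes 1])
  case 1
  show ?case by (auto intro!: exI[of _ 1] simp: lin_ext_def)
next
  case (2 c x y)
  let ?g = "\<lambda>N'. \<lambda>(a, q :: rat). sc \<lfloor>of_int N' * q\<rfloor> a"
  from 2(2) obtain M where M: "M > 0" "\<And>N'. M dvd N' \<Longrightarrow> lin_ext sc (?g N') y = 0" by blast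
  have "\<exists>N>0. \<forall>N'. N dvd N' \<longrightarrow> lin_ext sc (?g N') x = 0"
    using 2(1)
  proof
    assume "x \<in> {frag_of (a + a', b) - frag_of (a, b) - frag_of (a', b) | a a' b. True}"
    then show ?thesis
      by (auto intro!: exI[of _ 1] simp: lin_ext_diff lin_ext_frag_of scale_right_distrib)
  next
    assume "x \<in> {frag_of (a, b + b') - frag_of (a, b) - frag_of (a, b') | a b b'. True}"
    then obtain a b b' where x: "x = frag_of (a, b + b') - frag_of (a, b) - frag_of (a, b')" by blast
    obtain p q where pq: "quotient_of b = (p, q)" by (cases "quotient_of b")
    have q: "q > 0" "b = of_int p / of_int q"
      using quotient_of_denom_pos[OF pq] quotient_of_div[OF pq] by auto
    have "lin_ext sc (?g N') x = 0" if "q dvd N'" for N'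
    proof -
      from that obtain j where "N' = q * j" by blast
      then have "of_int N' * b = of_int (p * j)" using q by simp
      then have "\<lfloor>of_int N' * (b + b')\<rfloor> = \<lfloor>of_int N' * b\<rfloor> + \<lfloor>of_int N' * b'\<rfloor>"
        unfolding distrib_left by (metis floor_add_int floor_of_int add.commute)
      then show ?thesis by (simp add: x lin_ext_diff lin_ext_frag_of scale_left_distrib)
    qed
    then show ?thesis using q(1) by blast
  qed
  then obtain N where N: "N > 0" "\<And>N'. N dvd N' \<Longrightarrow> lin_ext sc (?g N') x = 0" by blast
  have "lin_ext sc (?g N') (frag_cmul c x + y) = 0" if "N * M dvd N'" for N'
  proof -
    have "N dvd N'" "M dvd N'" using that by (auto elim: dvd_mult_left dvd_mult_right)
    then show ?thesis using N(2) M(2) by (simp add: lin_ext_add lin_ext_cmul)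
  qed
  then show ?case using N(1) M(1) by (intro exI[of _ "N * M"]) auto
qed

text \<open>
  The homomorphism \<open>a \<otimes> q \<mapsto> N q a\<close> of the preceding lemma sends \<open>y \<otimes> 1\<close> to \<open>N y\<close>.
\<close>
lemma pure_tensor_eq_0_imp_torsion:
  assumes "pure_tensor y (1 :: rat) = 0"
  shows "\<exists>n\<noteq>0. sc n y = 0"
proof -
  from assms have "frag_of (y, 1 :: rat) \<in> tensor_relations"
    unfolding pure_tensor.abs_eq zero_tensor.abs_eq tensor.abs_eq_iff by simp
  from lin_ext_tensor_relations[OF this] obtain N where "N > 0" and
    N: "\<And>N'. N dvd N' \<Longrightarrow> lin_ext sc (\<lambda>(a, q :: rat). sc \<lfloor>of_int N' * q\<rfloor> a) (frag_of (y, 1)) = 0"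
    by blast
  have "sc N y = 0" using N[OF dvd_refl] by (simp add: lin_ext_frag_of)
  with \<open>N > 0\<close> show ?thesis by (intro exI[of _ N]) simp
qed

lemma pure_tensor_of_int: "pure_tensor y (of_int n :: rat) = pure_tensor (sc n y) 1"
proof -
  have z: "pure_tensor y (0 :: rat) = 0" "pure_tensor (0 :: 'm) (1 :: rat) = 0"
    using pure_tensor_add_right[of y 0 "0 :: rat"] pure_tensor_add_left[of "0 :: 'm" 0 "1 :: rat"] by simp_all
  show ?thesis
  proof (induction n rule: int_induct[where k = 0])
    case base
    then show ?case by (simp add: z)
  next
    case (step1 i)
    then show ?case by (simp add: pure_tensor_add_right pure_tensor_add_left scale_left_distrib)
  next
    case (step2 i)
    have "pure_tensor y (of_int i :: rat) = pure_tensor y (of_int (i - 1)) + pure_tensor y 1"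
      by (simp flip: pure_tensor_add_right)
    moreover have "pure_tensor (sc i y) (1 :: rat) = pure_tensor (sc (i - 1) y) 1 + pure_tensor y 1"
      by (simp add: scale_left_diff_distrib flip: pure_tensor_add_left)
    ultimately show ?case using step2 by simp
  qed
qed

end

lemma pure_tensor_sum: "pure_tensor (\<Sum>i\<in>I. h i) b = (\<Sum>i\<in>I. pure_tensor (h i) b)"
proof -
  have "pure_tensor 0 b = 0" using pure_tensor_add_left[of 0 0 b] by simp
  then show ?thesis
    by (induction I rule: infinite_finite_induct) (simp_all add: pure_tensor_add_left)
qed

text \<open>
  On the image of \<open>M\<close> the rational endomorphism \<open>p(t \<otimes> \<rat>)\<close> is induced by the element \<open>p(t)\<close> of the
  group ring, because the coefficients of \<open>p\<close> are integers.
\<close>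
lemma poly_endo_pure_tensor:
  fixes scale :: "('c::ab_group_add \<Rightarrow>\<^sub>0 int) \<Rightarrow> 'm::ab_group_add \<Rightarrow> 'm"
  assumes "Modules.module scale"
  shows "poly_endo rat_scale (of_int_poly p) (rat_action scale t) (pure_tensor x 1)
    = pure_tensor (scale (poly (of_int_poly p) (group_elem t)) x) 1"
proof -
  interpret Modules.module scale by fact
  let ?g = "group_elem t :: 'c \<Rightarrow>\<^sub>0 int"
  have sc: "Modules.module (\<lambda>n :: int. scale (of_int n))"
    by unfold_locales (simp_all add: scale_right_distrib scale_left_distrib)
  have iter: "(rat_action scale t ^^ i) (pure_tensor x r) = pure_tensor (scale (?g ^ i) x) r" for i r
    by (induction i) (simp_all add: rat_action_def tensor_map_pure scale_right_distrib)
  have deg: "degree (of_int_poly p :: rat poly) = degree p"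
    by (rule degree_map_poly) simp
  have "poly (of_int_poly p) ?g
      = (\<Sum>i\<le>degree (of_int_poly p :: ('c \<Rightarrow>\<^sub>0 int) poly). of_int (coeff p i) * ?g ^ i)"
    by (simp add: poly_altdef coeff_map_poly)
  also have "\<dots> = (\<Sum>i\<le>degree p. of_int (coeff p i) * ?g ^ i)"
  proof (rule sum.mono_neutral_left)
    show "{..degree (of_int_poly p :: ('c \<Rightarrow>\<^sub>0 int) poly)} \<subseteq> {..degree p}"
      using degree_map_poly_le[of "of_int :: int \<Rightarrow> 'c \<Rightarrow>\<^sub>0 int" p] by simp
    have "of_int (coeff p i) = (0 :: 'c \<Rightarrow>\<^sub>0 int)"
      if "i > degree (of_int_poly p :: ('c \<Rightarrow>\<^sub>0 int) poly)" for i
      using coeff_eq_0[OF that] by (simp add: coeff_map_poly)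
    then show "\<forall>i\<in>{..degree p} - {..degree (of_int_poly p :: ('c \<Rightarrow>\<^sub>0 int) poly)}.
        of_int (coeff p i) * ?g ^ i = 0" by auto
  qed simp
  finally have "poly (of_int_poly p) ?g = (\<Sum>i\<le>degree p. of_int (coeff p i) * ?g ^ i)" .
  then have "scale (poly (of_int_poly p) ?g) x
      = (\<Sum>i\<le>degree p. scale (of_int (coeff p i)) (scale (?g ^ i) x))"
    by (simp add: scale_sum_left)
  then show ?thesis
    by (simp add: poly_endo_def deg coeff_map_poly iter rat_scale_pure pure_tensor_sum
        pure_tensor_of_int[OF sc])
qed

section \<open>Powers of the augmentation ideal\<close>

lemma poly_eq_poly_1_plus_multiple:
  fixes g :: "'r::comm_ring_1"
  obtains h where "poly (of_int_poly f) g = of_int (poly f 1) + (g - 1) * h"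
proof -
  define c where "c = poly f 1"
  have "[:- 1, 1:] dvd f - [:c:]"
    using poly_eq_0_iff_dvd[of "f - [:c:]" 1] by (simp add: c_def)
  then obtain q where "f - [:c:] = [:- 1, 1:] * q" by blast
  then have f: "f = [:- 1, 1:] * q + [:c:]" by (simp only: diff_eq_eq)
  have "of_int_poly f = ([:- 1, 1:] * of_int_poly q + [:of_int c:] :: 'r poly)"
    unfolding f of_int_poly_hom.hom_add of_int_poly_hom.hom_mult
    by (simp add: poly_eq_iff coeff_map_poly coeff_pCons split: nat.split)
  then have "poly (of_int_poly f) g = poly ([:- 1, 1:] * of_int_poly q + [:of_int c:]) g"
    by (simp only:)
  also have "\<dots> = of_int (poly f 1) + (g - 1) * poly (of_int_poly q) g"
    by (simp add: algebra_simps c_def)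
  finally show ?thesis by (rule that)
qed

lemma module_ring: "Modules.module ((*) :: 'r::comm_ring_1 \<Rightarrow> _)"
  by unfold_locales (simp_all add: algebra_simps)

text \<open>
  The elements \<open>c\<close> with this property form a subgroup, by the identities (in
  multiplicative notation)
  \<open>a b - 1 = a (b - 1) + (a - 1)\<close> and \<open>t\<inverse> - 1 = - t\<inverse> (t - 1)\<close>.
\<close>
lemma minus_one_dvd_group_elem:
  assumes "c \<in> generate additive_group {t}"
  shows "group_elem t - 1 dvd group_elem c - 1"
  using assms
proof (induction rule: generate.induct)
  case one
  then show ?case by (simp add: additive_group_def group_elem_0)
next
  case (incl h)
  then show ?case by simp
next
  case (inv h)
  have "inv\<^bsub>additive_group\<^esub> t = - t"
    by (rule group.inv_equality[OF group_additive_group]) (simp_all add: additive_group_def)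
  moreover have "group_elem (- t) - 1 = - group_elem (- t) * (group_elem t - 1)"
    by (simp add: algebra_simps flip: group_elem_add) (simp add: group_elem_0)
  ultimately show ?case using inv by (metis dvd_triv_right singletonD)
next
  case (eng a b)
  have "group_elem (a + b) - 1 = group_elem a * (group_elem b - 1) + (group_elem a - 1)"
    by (simp add: algebra_simps group_elem_add)
  moreover have "group_elem t - 1 dvd \<dots>" by (intro dvd_add dvd_mult eng.IH)
  ultimately have "group_elem t - 1 dvd group_elem (a + b) - 1" by (simp only:)
  then show ?case by (simp add: additive_group_def)
qed

lemma minus_one_dvd_augmentation_ideal:
  assumes "generate additive_group {t} = UNIV" "r \<in> augmentation_ideal"
  shows "group_elem t - 1 dvd r"
proof -
  have cmul: "frag_cmul n (frag_of c) = of_int n * group_elem c" for n :: int and c :: 'a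
    by (rule poly_mapping_eqI) (simp add: group_elem_def flip: single_of_int, simp add: mult_single lookup_single when_def)
  let ?K = "Poly_Mapping.keys r" and ?n = "Poly_Mapping.lookup r"
  have "(\<Sum>c\<in>?K. ?n c) = 0" using assms(2) by (simp add: augmentation_ideal_def)
  then have 0: "(\<Sum>c\<in>?K. of_int (?n c)) = (0 :: 'a \<Rightarrow>\<^sub>0 int)"
    by (simp only: of_int_sum[symmetric] of_int_0)
  have "r = (\<Sum>c\<in>?K. frag_cmul (?n c) (frag_of c))"
    using frag_expansion[of r] by (simp add: frag_extend_def)
  also have "\<dots> = (\<Sum>c\<in>?K. of_int (?n c) * (group_elem c - 1))"
    by (simp add: cmul algebra_simps sum_subtractf 0)
  also have "group_elem t - 1 dvd \<dots>"
    by (intro dvd_sum dvd_mult minus_one_dvd_group_elem) (simp add: assms(1))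
  finally show ?thesis .
qed

lemma minus_one_in_augmentation_ideal: "group_elem c - 1 \<in> augmentation_ideal"
proof (cases "c = 0")
  case True
  then show ?thesis by (simp add: augmentation_ideal_def group_elem_0)
next
  case False
  have "Poly_Mapping.keys (group_elem c - 1) \<subseteq> {c, 0}"
    using keys_diff[of "group_elem c" 1] by (auto simp: group_elem_def)
  then have "(\<Sum>d\<in>Poly_Mapping.keys (group_elem c - 1). Poly_Mapping.lookup (group_elem c - 1) d)
      = (\<Sum>d\<in>{c, 0}. Poly_Mapping.lookup (group_elem c - 1) d)"
    by (intro sum.mono_neutral_left) (auto simp: in_keys_iff)
  then show ?thesis
    using False by (simp add: augmentation_ideal_def lookup_minus group_elem_def lookup_single lookup_one)
qed

lemma power_in_ideal_power: "a \<in> J \<Longrightarrow> a ^ n \<in> ideal_power J n"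
proof (induction n)
  interpret R: Modules.module "(*) :: 'a \<Rightarrow> _" by (rule module_ring)
  case (Suc n)
  then show ?case by (auto simp: ideal_smult_def intro!: R.span_base)
qed simp

lemma ideal_power_dvd:
  assumes "\<And>r. r \<in> J \<Longrightarrow> a dvd r"
  shows "r \<in> ideal_power J n \<Longrightarrow> a ^ n dvd r"
proof (induction n arbitrary: r)
  interpret R: Modules.module "(*) :: 'a \<Rightarrow> _" by (rule module_ring)
  case (Suc n)
  have "ideal_power J (Suc n) \<subseteq> {r. a ^ Suc n dvd r}"
    unfolding ideal_power.simps ideal_smult_def
  proof (rule R.span_minimal)
    show "{r * x |r x. r \<in> J \<and> x \<in> ideal_power J n} \<subseteq> {r. a ^ Suc n dvd r}"
      using assms Suc.IH by (auto intro: mult_dvd_mono)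
  qed (auto simp: R.subspace_def)
  then show ?case using Suc.prems by blast
qed simp

lemma ideal_smult_principal:
  fixes scale :: "'r::comm_ring_1 \<Rightarrow> 'm::ab_group_add \<Rightarrow> 'm"
  assumes "Modules.module scale" "a \<in> J" "\<And>r. r \<in> J \<Longrightarrow> a dvd r"
  shows "ideal_smult scale (ideal_power J n) UNIV = range (scale (a ^ n))"
proof
  interpret Modules.module scale by fact
  show "range (scale (a ^ n)) \<subseteq> ideal_smult scale (ideal_power J n) UNIV"
    unfolding ideal_smult_def using power_in_ideal_power[OF assms(2)] by (auto intro: span_base)
  have "scale r x \<in> range (scale (a ^ n))" if "r \<in> ideal_power J n" for r x
  proof -
    from ideal_power_dvd[OF assms(3) that] obtain s where "r = a ^ n * s" by blast
    then have "scale r x = scale (a ^ n) (scale s x)" by simp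
    then show ?thesis by blast
  qed
  moreover have "subspace (range (scale (a ^ n)))"
  proof (rule subspaceI)
    show "0 \<in> range (scale (a ^ n))" by (rule range_eqI[of _ _ 0]) simp
    show "x + y \<in> range (scale (a ^ n))" if "x \<in> range (scale (a ^ n))" "y \<in> range (scale (a ^ n))" for x y
      using that by (auto simp flip: scale_right_distrib)
    show "scale c x \<in> range (scale (a ^ n))" if "x \<in> range (scale (a ^ n))" for c x
    proof -
      from that obtain y where "x = scale (a ^ n) y" by blast
      then have "scale c x = scale (a ^ n) (scale c y)" by (simp only: scale_left_commute[of c])
      then show ?thesis by blast
    qed
  qed
  ultimately show "ideal_smult scale (ideal_power J n) UNIV \<subseteq> range (scale (a ^ n))"
    unfolding ideal_smult_def by (intro span_minimal) auto
qed

text \<open>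
  Each of the finitely many elements of \<open>T\<close> leaves the chain at some stage or stays in it forever.
\<close>
lemma decreasing_Int_finite_stable:
  fixes V :: "nat \<Rightarrow> 'a set"
  assumes "finite T" "decseq V"
  obtains k where "\<And>n. n \<ge> k \<Longrightarrow> T \<inter> V n = T \<inter> V (Suc n)"
proof -
  have "\<exists>k. \<forall>n\<ge>k. x \<in> V n \<longrightarrow> x \<in> V (Suc n)" for x
  proof (cases "\<forall>n. x \<in> V n")
    case False
    then obtain k where k: "x \<notin> V k" by blast
    then have "x \<notin> V n" if "n \<ge> k" for n using decseqD[OF assms(2) that] by blast
    then show ?thesis by blast
  qed auto
  then have "\<exists>k. \<forall>x. \<forall>n\<ge>k x. x \<in> V n \<longrightarrow> x \<in> V (Suc n)" by (intro choice allI)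
  then obtain k where k: "\<And>x n. n \<ge> k x \<Longrightarrow> x \<in> V n \<Longrightarrow> x \<in> V (Suc n)" by blast
  have "T \<inter> V n = T \<inter> V (Suc n)" if n: "n \<ge> (\<Sum>x\<in>T. k x)" for n
  proof -
    have "k x \<le> n" if "x \<in> T" for x
      using member_le_sum[of x T k] that n assms(1) by simp
    then have "x \<in> V (Suc n)" if "x \<in> T" "x \<in> V n" for x
      using k that by blast
    moreover have "V (Suc n) \<subseteq> V n" by (rule decseqD[OF assms(2)]) simp
    ultimately show ?thesis by blast
  qed
  then show ?thesis by (rule that)
qed

section \<open>Tame modules over an infinite cyclic group\<close>

text \<open>
  A generator of finite order would have only finitely many powers.
\<close>
lemma bij_int_pow_generator:
  fixes t :: "'c::ab_group_add"
  assumes gen: "generate additive_group {t} = UNIV" and inf: "infinite (UNIV :: 'c set)"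
  shows "bij (\<lambda>k::int. t [^]\<^bsub>additive_group\<^esub> k)"
proof -
  interpret G: group "additive_group :: 'c monoid" by (rule group_additive_group)
  have t: "t \<in> carrier additive_group" by (simp add: additive_group_def)
  have range: "range (\<lambda>k::int. t [^]\<^bsub>additive_group\<^esub> k) = UNIV"
    using G.generate_pow[OF t] gen by (simp add: full_SetCompr_eq)
  have no_period: "t [^]\<^bsub>additive_group\<^esub> d \<noteq> \<one>\<^bsub>additive_group\<^esub>" if d: "d > 0" for d :: int
  proof
    assume 1: "t [^]\<^bsub>additive_group\<^esub> d = \<one>\<^bsub>additive_group\<^esub>"
    have "t [^]\<^bsub>additive_group\<^esub> k = t [^]\<^bsub>additive_group\<^esub> (k mod d)" for k
      using G.int_pow_mult[OF t, of "d * (k div d)" "k mod d"] G.int_pow_closed[OF t, of "k mod d"]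
      by (simp add: G.int_pow_pow[OF t, symmetric] 1)
    then have "range (\<lambda>k::int. t [^]\<^bsub>additive_group\<^esub> k)
        \<subseteq> (\<lambda>k::int. t [^]\<^bsub>additive_group\<^esub> k) ` {0..<d}"
      using d by (intro image_subsetI) (rule image_eqI, assumption, simp)
    then have "finite (UNIV :: 'c set)" unfolding range by (rule finite_subset) simp
    with inf show False by simp
  qed
  have "inj (\<lambda>k::int. t [^]\<^bsub>additive_group\<^esub> k)"
  proof (rule linorder_inj_onI')
    fix j k :: int assume "j < k"
    then show "t [^]\<^bsub>additive_group\<^esub> j \<noteq> t [^]\<^bsub>additive_group\<^esub> k"
      using no_period[of "k - j"] G.int_pow_diff[OF t, of k j] G.int_pow_closed[OF t, of k] by auto
  qed
  with range show ?thesis by (simp add: bij_def)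
qed

text \<open>
  The choice of the generator identifies \<open>C\<close> with the integers and the semidirect product with the
  extension attached to the powers of \<open>t\<close>.
\<close>
lemma tame_finite_torsion:
  fixes scale :: "('c::ab_group_add \<Rightarrow>\<^sub>0 int) \<Rightarrow> 'm::ab_group_add \<Rightarrow> 'm" and t :: 'c
  assumes "Modules.module scale" and gen: "generate additive_group {t} = UNIV"
    and inf: "infinite (UNIV :: 'c set)" and fp: "finitely_presented (semidirect scale)"
  shows "finite {x. \<exists>n\<noteq>0. scale (of_int n) x = 0}"
proof -
  interpret Modules.module scale by fact
  interpret C: group "additive_group :: 'c monoid" by (rule group_additive_group)
  define pow where "pow k = t [^]\<^bsub>additive_group\<^esub> k" for k :: int
  have t: "t \<in> carrier additive_group" by (simp add: additive_group_def)
  have pow_add: "pow (j + k) = pow j + pow k" for j k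
    using C.int_pow_mult[OF t, of j k] by (simp add: pow_def additive_group_def)
  have pow_0: "pow 0 = 0" by (simp add: pow_def additive_group_def)
  have bij: "bij pow" unfolding pow_def[abs_def] by (rule bij_int_pow_generator[OF gen inf])
  interpret A: int_action "\<lambda>n. scale (of_int n)" "\<lambda>k. scale (group_elem (pow k))"
    by unfold_locales
      (simp_all add: scale_right_distrib scale_left_distrib pow_0 pow_add group_elem_0 group_elem_add)
  have "map_prod id pow \<in> iso A.extension (semidirect scale)"
  proof (rule isoI)
    show "map_prod id pow \<in> hom A.extension (semidirect scale)"
      by (rule homI) (auto simp: semidirect_def pow_add)
    show "bij_betw (map_prod id pow) (carrier A.extension) (carrier (semidirect scale))"
      using bij by (auto simp: A.extension_def semidirect_def bij_def prod.inj_map map_prod_surj)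
  qed
  then have "A.extension \<cong> semidirect scale" by (rule is_isoI)
  then have "semidirect scale \<cong> A.extension" by (rule group.iso_sym[OF A.group_extension])
  then show ?thesis by (intro A.finite_torsion finitely_presented_iso[OF fp])
qed

text \<open>
  With \<open>e = f(1)\<close>, so that \<open>e^2 = 1\<close>, the element \<open>z = e a^n f(t) x\<close> is torsion for \<open>n \<ge> m\<close> and equals
  \<open>a^n x + e h a^(n+1) x\<close>. Being torsion and in \<open>a^n M\<close>, it lies in \<open>a^(n+1) M\<close> as soon as the
  intersections with the torsion subgroup have stabilised; then so does \<open>a^n x\<close>.
\<close>
lemma prenilpotent_if_finite_torsion:
  fixes scale :: "('c::ab_group_add \<Rightarrow>\<^sub>0 int) \<Rightarrow> 'm::ab_group_add \<Rightarrow> 'm"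
  assumes "Modules.module scale" and gen: "generate additive_group {t} = UNIV"
    and fin: "finite {x. \<exists>n\<noteq>0. scale (of_int n) x = 0}"
    and kills: "\<And>x. \<exists>n\<noteq>0. scale (of_int n)
      (scale (poly (of_int_poly ([:- 1, 1:] ^ m * f)) (group_elem t)) x) = 0"
    and f1: "poly f 1 \<in> {- 1, 1}"
  shows "prenilpotent scale"
proof -
  interpret Modules.module scale by fact
  let ?T = "{x. \<exists>n\<noteq>0. scale (of_int n) x = 0}"
  define a where "a = group_elem t - (1 :: 'c \<Rightarrow>\<^sub>0 int)"
  define V where "V n = range (scale (a ^ n))" for n
  have smult: "ideal_smult scale (ideal_power augmentation_ideal n) UNIV = V n" for n
    unfolding V_def a_def
    by (rule ideal_smult_principal[OF assms(1) minus_one_in_augmentation_ideal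
          minus_one_dvd_augmentation_ideal[OF gen]])
  have V_Suc: "scale (a ^ Suc n) x \<in> V (Suc n)" for n x by (auto simp: V_def)
  have V_mono: "V (Suc n) \<subseteq> V n" for n
  proof (unfold V_def, intro image_subsetI)
    fix x
    have "scale (a ^ Suc n) x = scale (a ^ n) (scale a x)" by (simp add: mult.commute)
    then show "scale (a ^ Suc n) x \<in> range (scale (a ^ n))" by blast
  qed
  have sub: "x + scale r y \<in> V n" if "x \<in> V n" "y \<in> V n" for x y r n
  proof -
    from that obtain x' y' where "x = scale (a ^ n) x'" "y = scale (a ^ n) y'" by (auto simp: V_def)
    then have "x + scale r y = scale (a ^ n) (x' + scale r y')"
      by (simp add: scale_right_distrib mult.commute)
    then show ?thesis by (auto simp: V_def)
  qed
  obtain h where h: "poly (of_int_poly f) (group_elem t) = of_int (poly f 1) + a * h"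
    unfolding a_def by (rule poly_eq_poly_1_plus_multiple)
  define e where "e = poly f 1"
  have e: "of_int e * of_int e = (1 :: 'c \<Rightarrow>\<^sub>0 int)"
    using f1 by (auto simp: e_def)
  have "poly (of_int_poly ([:- 1, 1:] ^ m * f)) (group_elem t) = a ^ m * (of_int e + a * h)"
    by (simp add: of_int_poly_hom.hom_mult of_int_poly_hom.hom_power map_poly_pCons h e_def a_def)
  then have T: "scale (a ^ m * (of_int e + a * h)) x \<in> ?T" for x using kills[of x] by simp
  obtain k where k: "\<And>n. n \<ge> k \<Longrightarrow> ?T \<inter> V n = ?T \<inter> V (Suc n)"
    using decreasing_Int_finite_stable[OF fin decseq_SucI[of V, OF V_mono]] by blast
  have "V n = V (Suc n)" if n: "n \<ge> max k m" for n
  proof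
    show "V n \<subseteq> V (Suc n)"
    proof
      fix y assume "y \<in> V n"
      then obtain x where y: "y = scale (a ^ n) x" by (auto simp: V_def)
      define z where "z = scale (of_int e * a ^ n * (of_int e + a * h)) x"
      have "a ^ n = a ^ m * a ^ (n - m)" using n by (simp flip: power_add)
      then have "z = scale (a ^ m * (of_int e + a * h)) (scale (of_int e * a ^ (n - m)) x)"
        by (simp add: z_def mult_ac)
      then have "z \<in> ?T" by (simp only: T)
      moreover have "z = scale (a ^ n) (scale (of_int e * (of_int e + a * h)) x)"
        by (simp add: z_def mult_ac)
      then have "z \<in> V n" unfolding V_def by (rule range_eqI)
      ultimately have "z \<in> V (Suc n)" using k[of n] n by auto
      moreover have "of_int e * a ^ n * (of_int e + a * h)
          = a ^ n * (of_int e * of_int e) + of_int e * h * a ^ Suc n"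
        by (simp add: algebra_simps)
      then have "z = y + scale (of_int e * h) (scale (a ^ Suc n) x)"
        by (simp add: z_def y e scale_left_distrib)
      then have "y = z + scale (- (of_int e * h)) (scale (a ^ Suc n) x)" by simp
      ultimately show "y \<in> V (Suc n)" using sub[OF _ V_Suc] by blast
    qed
  qed (rule V_mono)
  then show ?thesis unfolding prenilpotent_def smult by blast
qed

theorem corollary4p17:
  fixes scale :: "('c::ab_group_add \<Rightarrow>\<^sub>0 int) \<Rightarrow> 'm::ab_group_add \<Rightarrow> 'm"
    and t :: 'c and m :: nat and f :: "int poly"
  assumes "cyclic_group (additive_group :: 'c monoid)" and "infinite (UNIV :: 'c set)"
    and "Modules.module scale" and "tame scale"
    and "integral_generator scale t"
    and "is_min_poly_of rat_scale (rat_action scale t) (of_int_poly ([:-1, 1:] ^ m * f))"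
    and "poly f 1 \<in> {-1, 1}"
  shows "prenilpotent scale"
proof -
  interpret Modules.module scale by fact
  let ?p = "[:-1, 1:] ^ m * f"
  have gen: "generate additive_group {t} = UNIV"
    using assms(5) by (simp add: integral_generator_def)
  have fin: "finite {x. \<exists>n\<noteq>0. scale (of_int n) x = 0}"
    using assms(4) by (intro tame_finite_torsion[OF assms(3) gen assms(2)]) (simp add: tame_def)
  have sc: "Modules.module (\<lambda>n :: int. scale (of_int n))"
    by unfold_locales (simp_all add: scale_right_distrib scale_left_distrib)
  have "pure_tensor (scale (poly (of_int_poly ?p) (group_elem t)) x) (1 :: rat) = 0" for x
    using assms(6) unfolding is_min_poly_of_def poly_endo_pure_tensor[OF assms(3), symmetric] by blast
  then have "\<exists>n\<noteq>0. scale (of_int n) (scale (poly (of_int_poly ?p) (group_elem t)) x) = 0" for x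
    by (rule pure_tensor_eq_0_imp_torsion[OF sc])
  then show ?thesis by (rule prenilpotent_if_finite_torsion[OF assms(3) gen fin _ assms(7)])
qed

end
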